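(* Let $(\Phi,\bar y)$ be a relatively normalized ovaloid of $\mathbb{R}^3$, with support function $q$ and scalar curvature $S$ of the relative metric, and let $q_{\mathrm{aff}}$, $S_{\mathrm{aff}}$ be the corresponding quantities for the equiaffine normalization $\bar y_{\mathrm{aff}}$ of $\Phi$. If the function $$\frac{S}{q}-\frac{S_{\mathrm{aff}}}{q_{\mathrm{aff}}}$$ does not change its sign on $M$, then $\bar y$ and $\bar y_{\mathrm{aff}}$ are constantly proportional.
   Context: An ovaloid $\Phi=(M,\bar x)$ in $\mathbb{R}^3$ is a closed surface of positive Gaussian curvature: $M$ is an oriented connected compact $2$-dimensional $C^r$-manifold without boundary ($r\ge3$) and $\bar x:M\to\mathbb{R}^3$ is a $C^r$-immersion with Gaussian curvature $K_I>0$. Let $u^1,u^2$ be local coordinates and write $f_{/i}=\partial f/\partial u^i$, etc. Let $\bar\xi$ be the Euclidean unit normal field and $h_{ij}=\langle\bar\xi,\bar x_{/ij}\rangle$ the components of the second fundamental form $II$. A $C^s$-map $\bar y:M\to\mathbb{R}^{3}$ ($r>s\ge1$) is a relative normalization of $\Phi$ if at every point of $M$ the vectors $\bar x_{/1},\bar x_{/2},\bar y$ are linearly independent and every $\bar y_{/i}$ lies in the span of $\bar x_{/1},\bar x_{/2}$; then $(\Phi,\bar y)$ is called relatively normalized. Here $r,s$ are understood to be large enough for all quantities involved to be defined. The support function of $\bar y$ is $q=\langle\bar\xi,\bar y\rangle$; it never vanishes, and orientations are chosen so that $q>0$ (with the same $\bar\xi$ for all relative normalizations being compared). The covector $\bar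 X$ is defined by $\langle\bar X,\bar x_{/i}\rangle=0$ for all $i$ and $\langle\bar X,\bar y\rangle=1$, so $\bar X=q^{-1}\bar\xi$. The relative metric is $G_{ij}=\langle\bar X,\bar x_{/ij}\rangle=q^{-1}h_{ij}$. $S$ is the scalar curvature of $G$, normalized so that for these surfaces it is the Gaussian curvature of $G$, i.e. $S=\frac12G^{ij}R_{ij}$ with $R_{ij}$ the Ricci tensor of $G$ (sign convention giving $+1$ for the round unit sphere). The equiaffine normalization $\bar y_{\mathrm{aff}}$ is the (unique) relative normalization with support function $q_{\mathrm{aff}}=|K_I|^{1/4}$; $S_{\mathrm{aff}}$ is the scalar curvature of its relative metric (the inner equiaffine curvature). The normalizations $\bar y$ and $\bar y_{\mathrm{aff}}$ are called constantly proportional if $q=c\,q_{\mathrm{aff}}$ for a constant $c\in\mathbb{R}\setminus\{0\}$ (equivalently $\bar y=c\,\bar y_{\mathrm{aff}}$). "Does not change its sign on $M$" means: is everywhere $\ge0$ or everywhere $\le0$ on $M$. *)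

theory Defs
  imports "HOL-Analysis.Analysis"
begin

section \<open>Calculus in coordinates\<close>

definition partial :: "2 \<Rightarrow> (real^2 \<Rightarrow> 'b::real_normed_vector) \<Rightarrow> real^2 \<Rightarrow> 'b" where
  "partial i f u = frechet_derivative f (at u) (axis i 1)"

(* Used only for open sets D, where it is the usual notion of class C^k. *)
primrec Ck_on :: "nat \<Rightarrow> (real^2 \<Rightarrow> 'b::real_normed_vector) \<Rightarrow> (real^2) set \<Rightarrow> bool" where
  "Ck_on 0 f D \<longleftrightarrow> continuous_on D f"
| "Ck_on (Suc k) f D \<longleftrightarrow> (\<forall>u\<in>D. f differentiable (at u)) \<and> (\<forall>i. Ck_on k (partial i f) D)"

section \<open>Compact oriented surfaces\<close>

(* A chart is a pair (U, \<phi>); \<phi> is only relevant on U. *)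
type_synonym 'a chart = "'a set \<times> ('a \<Rightarrow> real^2)"

definition in_chart :: "'a chart \<Rightarrow> ('a \<Rightarrow> 'b) \<Rightarrow> real^2 \<Rightarrow> 'b" where
  "in_chart c f = f \<circ> inv_into (fst c) (snd c)"

definition is_chart :: "'a topology \<Rightarrow> 'a chart \<Rightarrow> bool" where
  "is_chart M c \<longleftrightarrow>
     openin M (fst c) \<and> open (snd c ` fst c) \<and>
     homeomorphic_map (subtopology M (fst c)) (top_of_set (snd c ` fst c)) (snd c)"

definition oriented_atlas :: "nat \<Rightarrow> 'a topology \<Rightarrow> 'a chart set \<Rightarrow> bool" where
  "oriented_atlas r M A \<longleftrightarrow>
     (\<forall>c\<in>A. is_chart M c) \<and> (\<Union>c\<in>A. fst c) = topspace M \<and>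
     (\<forall>c\<in>A. \<forall>d\<in>A.
        Ck_on r (in_chart c (snd d)) (snd c ` (fst c \<inter> fst d)) \<and>
        (\<forall>u \<in> snd c ` (fst c \<inter> fst d).
           det (matrix (frechet_derivative (in_chart c (snd d)) (at u))) > 0))"

definition closed_oriented_surface :: "nat \<Rightarrow> 'a topology \<Rightarrow> 'a chart set \<Rightarrow> bool" where
  "closed_oriented_surface r M A \<longleftrightarrow>
     topspace M \<noteq> {} \<and> Hausdorff_space M \<and> compact_space M \<and> connected_space M \<and>
     oriented_atlas r M A"

definition Ck_map :: "nat \<Rightarrow> 'a chart set \<Rightarrow> ('a \<Rightarrow> real^3) \<Rightarrow> bool" where
  "Ck_map k A f \<longleftrightarrow> (\<forall>c\<in>A. Ck_on k (in_chart c f) (snd c ` fst c))"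

definition Ck_immersion :: "nat \<Rightarrow> 'a chart set \<Rightarrow> ('a \<Rightarrow> real^3) \<Rightarrow> bool" where
  "Ck_immersion k A x \<longleftrightarrow> Ck_map k A x \<and>
     (\<forall>c\<in>A. \<forall>u \<in> snd c ` fst c. inj (frechet_derivative (in_chart c x) (at u)))"

section \<open>Euclidean invariants and ovaloids\<close>

(* f_{/i} and f_{/ij} with respect to the chart c, as functions of the point of the surface *)
definition D1 :: "'a chart \<Rightarrow> ('a \<Rightarrow> real^3) \<Rightarrow> 2 \<Rightarrow> 'a \<Rightarrow> real^3" where
  "D1 c f i p = partial i (in_chart c f) (snd c p)"

definition D2 :: "'a chart \<Rightarrow> ('a \<Rightarrow> real^3) \<Rightarrow> 2 \<Rightarrow> 2 \<Rightarrow> 'a \<Rightarrow> real^3" where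
  "D2 c f i j p = partial j (partial i (in_chart c f)) (snd c p)"

(* On a connected orientable surface there are exactly two such fields, differing by the sign. *)
definition unit_normal_field ::
    "'a topology \<Rightarrow> 'a chart set \<Rightarrow> ('a \<Rightarrow> real^3) \<Rightarrow> ('a \<Rightarrow> real^3) \<Rightarrow> bool" where
  "unit_normal_field M A x \<xi> \<longleftrightarrow>
     continuous_map M euclidean \<xi> \<and> (\<forall>p\<in>topspace M. norm (\<xi> p) = 1) \<and>
     (\<forall>c\<in>A. \<forall>p\<in>fst c. \<forall>i. \<xi> p \<bullet> D1 c x i p = 0)"

definition first_form :: "'a chart \<Rightarrow> ('a \<Rightarrow> real^3) \<Rightarrow> 'a \<Rightarrow> real^2^2" where
  "first_form c x p = (\<chi> i j. D1 c x i p \<bullet> D1 c x j p)"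

definition second_form :: "'a chart \<Rightarrow> ('a \<Rightarrow> real^3) \<Rightarrow> ('a \<Rightarrow> real^3) \<Rightarrow> 'a \<Rightarrow> real^2^2" where
  "second_form c x \<xi> p = (\<chi> i j. \<xi> p \<bullet> D2 c x i j p)"

definition gauss_curvature :: "'a chart \<Rightarrow> ('a \<Rightarrow> real^3) \<Rightarrow> ('a \<Rightarrow> real^3) \<Rightarrow> 'a \<Rightarrow> real" where
  "gauss_curvature c x \<xi> p = det (second_form c x \<xi> p) / det (first_form c x p)"

definition ovaloid ::
    "nat \<Rightarrow> 'a topology \<Rightarrow> 'a chart set \<Rightarrow> ('a \<Rightarrow> real^3) \<Rightarrow> ('a \<Rightarrow> real^3) \<Rightarrow> bool" where
  "ovaloid r M A x \<xi> \<longleftrightarrow>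
     closed_oriented_surface r M A \<and> Ck_immersion r A x \<and> unit_normal_field M A x \<xi> \<and>
     (\<forall>c\<in>A. \<forall>p\<in>fst c. gauss_curvature c x \<xi> p > 0)"

section \<open>Relative normalizations\<close>

definition relative_normalization ::
    "nat \<Rightarrow> 'a chart set \<Rightarrow> ('a \<Rightarrow> real^3) \<Rightarrow> ('a \<Rightarrow> real^3) \<Rightarrow> bool" where
  "relative_normalization s A x y \<longleftrightarrow> Ck_map s A y \<and>
     (\<forall>c\<in>A. \<forall>p\<in>fst c.
        (\<forall>a b d. a *\<^sub>R D1 c x 1 p + b *\<^sub>R D1 c x 2 p + d *\<^sub>R y p = 0
                  \<longrightarrow> a = 0 \<and> b = 0 \<and> d = 0) \<and>
        (\<forall>i. D1 c y i p \<in> span {D1 c x 1 p, D1 c x 2 p}))"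

definition support_function :: "('a \<Rightarrow> real^3) \<Rightarrow> ('a \<Rightarrow> real^3) \<Rightarrow> 'a \<Rightarrow> real" where
  "support_function \<xi> y p = \<xi> p \<bullet> y p"

(* The covector X of the normalization y; see covector_iff. *)
definition covector :: "('a \<Rightarrow> real^3) \<Rightarrow> ('a \<Rightarrow> real^3) \<Rightarrow> 'a \<Rightarrow> real^3" where
  "covector \<xi> y p = inverse (support_function \<xi> y p) *\<^sub>R \<xi> p"

lemma covector_iff:
  assumes "relative_normalization s A x y" and "unit_normal_field M A x \<xi>"
    and "c \<in> A" "p \<in> fst c" and "support_function \<xi> y p \<noteq> 0"
  shows "(\<forall>i. X \<bullet> D1 c x i p = 0) \<and> X \<bullet> y p = 1 \<longleftrightarrow> X = covector \<xi> y p"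
proof
  let ?a = "D1 c x 1 p" and ?b = "D1 c x 2 p" and ?y = "y p"
  have n: "\<xi> p \<bullet> D1 c x i p = 0" for i
    using assms(2-4) unfolding unit_normal_field_def by blast
  have C: "(\<forall>i. covector \<xi> y p \<bullet> D1 c x i p = 0) \<and> covector \<xi> y p \<bullet> y p = 1"
    using n assms(5) by (simp add: covector_def support_function_def)
  show "(\<forall>i. X \<bullet> D1 c x i p = 0) \<and> X \<bullet> y p = 1" if "X = covector \<xi> y p"
    using C that by simp
  assume X: "(\<forall>i. X \<bullet> D1 c x i p = 0) \<and> X \<bullet> y p = 1"
  define Z where "Z = X - covector \<xi> y p"
  have Z: "Z \<bullet> ?a = 0" "Z \<bullet> ?b = 0" "Z \<bullet> ?y = 0"
    using X C by (simp_all add: Z_def inner_diff_left)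
  have li: "u = 0 \<and> v = 0 \<and> w = 0" if "u *\<^sub>R ?a + v *\<^sub>R ?b + w *\<^sub>R ?y = 0" for u v w
    using assms(1,3,4) that unfolding relative_normalization_def by blast
  define T :: "real^3 \<Rightarrow> real^3"
    where "T = (\<lambda>t. (t $ 1) *\<^sub>R ?a + (t $ 2) *\<^sub>R ?b + (t $ 3) *\<^sub>R ?y)"
  have lin: "linear T"
    by (rule linearI) (simp_all add: T_def algebra_simps)
  have "t = 0" if "T t = 0" for t
    using li[of "t $ 1" "t $ 2" "t $ 3"] that
    by (simp add: T_def vec_eq_iff forall_3)
  then have "inj T"
    using lin linear_injective_0 by blast
  then have "surj T"
    using lin linear_injective_imp_surjective by blast
  then obtain t where "Z = T t"
    by (metis surjD)
  then have "Z \<bullet> Z = 0"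
    using Z by (metis (no_types, lifting) T_def add.right_neutral inner_add_right
        inner_scaleR_right mult_zero_right)
  then show "X = covector \<xi> y p"
    by (simp add: Z_def)
qed

definition relative_metric ::
    "'a chart \<Rightarrow> ('a \<Rightarrow> real^3) \<Rightarrow> ('a \<Rightarrow> real^3) \<Rightarrow> ('a \<Rightarrow> real^3) \<Rightarrow> 'a \<Rightarrow> real^2^2" where
  "relative_metric c x \<xi> y p = (\<chi> i j. covector \<xi> y p \<bullet> D2 c x i j p)"

definition equiaffine_normalization ::
    "nat \<Rightarrow> 'a chart set \<Rightarrow> ('a \<Rightarrow> real^3) \<Rightarrow> ('a \<Rightarrow> real^3) \<Rightarrow> ('a \<Rightarrow> real^3) \<Rightarrow> bool" where
  "equiaffine_normalization s A x \<xi> y \<longleftrightarrow> relative_normalization s A x y \<and>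
     (\<forall>c\<in>A. \<forall>p\<in>fst c. support_function \<xi> y p = \<bar>gauss_curvature c x \<xi> p\<bar> powr (1/4))"

definition constantly_proportional ::
    "'a topology \<Rightarrow> ('a \<Rightarrow> real^3) \<Rightarrow> ('a \<Rightarrow> real^3) \<Rightarrow> ('a \<Rightarrow> real^3) \<Rightarrow> bool" where
  "constantly_proportional M \<xi> y z \<longleftrightarrow>
     (\<exists>k. k \<noteq> 0 \<and> (\<forall>p\<in>topspace M. support_function \<xi> y p = k * support_function \<xi> z p))"

section \<open>Curvature of a metric given in coordinates\<close>

definition christoffel :: "(real^2 \<Rightarrow> real^2^2) \<Rightarrow> 2 \<Rightarrow> 2 \<Rightarrow> 2 \<Rightarrow> real^2 \<Rightarrow> real" where
  "christoffel g k i j u = (1/2) * (\<Sum>l\<in>UNIV. matrix_inv (g u) $ k $ l *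
     (partial i (\<lambda>v. g v $ j $ l) u + partial j (\<lambda>v. g v $ i $ l) u - partial l (\<lambda>v. g v $ i $ j) u))"

(* The sign is such that the Ricci tensor of the round unit sphere equals its metric. *)
definition ricci :: "(real^2 \<Rightarrow> real^2^2) \<Rightarrow> 2 \<Rightarrow> 2 \<Rightarrow> real^2 \<Rightarrow> real" where
  "ricci g i j u =
     (\<Sum>k\<in>UNIV. partial k (christoffel g k i j) u - partial j (christoffel g k i k) u) +
     (\<Sum>k\<in>UNIV. \<Sum>l\<in>UNIV. christoffel g k k l u * christoffel g l i j u
                          - christoffel g k j l u * christoffel g l i k u)"

definition scalar_curvature :: "(real^2 \<Rightarrow> real^2^2) \<Rightarrow> real^2 \<Rightarrow> real" where
  "scalar_curvature g u = (1/2) * (\<Sum>i\<in>UNIV. \<Sum>j\<in>UNIV. matrix_inv (g u) $ i $ j * ricci g i j u)"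

(* The scalar curvature at p of the relative metric, computed in the chart c around p;
   as usual, the value does not depend on the choice of c. *)
definition relative_scalar_curvature ::
    "'a chart \<Rightarrow> ('a \<Rightarrow> real^3) \<Rightarrow> ('a \<Rightarrow> real^3) \<Rightarrow> ('a \<Rightarrow> real^3) \<Rightarrow> 'a \<Rightarrow> real" where
  "relative_scalar_curvature c x \<xi> y p =
     scalar_curvature (in_chart c (relative_metric c x \<xi> y)) (snd c p)"

end

theory Submission
  imports Defs
begin

text \<open>Put $\varphi = \ln (q / q_{\mathrm{aff}})$. The two relative metrics are conformal, $G = e^{-\varphi}
  G_{\mathrm{aff}}$, and the transformation of the Gaussian curvature under conformal changes gives
  $S/q - S_{\mathrm{aff}}/q_{\mathrm{aff}} = \Delta \varphi / (2 q_{\mathrm{aff}})$ with the Laplacian of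
  $G_{\mathrm{aff}}$. If the left-hand side has constant sign, then $\varphi$ is sub- or superharmonic
  on the compact connected surface $M$, hence constant by Hopf's strong maximum principle. Only the positivity
  of $q_{\mathrm{aff}}$ enters, not its special form. The metrics may be negative definite, according to the
  orientation of the normal field, but by connectedness the sign is the same on all of $M$.\<close>

section \<open>Partial derivatives and functions of class $C^k$\<close>

text \<open>The weight 1/q is tied to dimension two. For surfaces the curvature of exp \<mu> times g
  is exp (- \<mu>) times (S - \<Delta>\<mu> / 2), and the support functions differ by the same
  exponential, so it cancels in the quotients and the difference is linear in \<mu>. The conformal
  formula is obtained from the Christoffel symbols in arbitrary coordinates. The obstacle there is
  the inverse metric, whose derivatives would make the computation rational. It is avoided by
  treating the contravariant gradient of \<mu> as a variable and by eliminating the derivatives of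
  the metric through its covariant constancy. A second obstacle is regularity: the curvatures
  require metrics of class C^2, hence support functions of class C^2, while the normalizations
  themselves may be only C^1. A third is that definiteness has to be compared between charts. At a
  point p the second fundamental form is the Hessian of the height function in the direction of the
  normal at p, and p is a critical point of that function; this gives the transformation law without
  derivatives of the normal field.\<close>

lemma partial_eqI:
  assumes "(f has_derivative f') (at u)"
  shows "partial i f u = f' (axis i 1)"
  using frechet_derivative_at[OF assms] by (simp add: partial_def)

text \<open>Having a given derivative depends only on the germ of the function. As
  \<open>frechet_derivative\<close> is a choice from the set of derivatives, equal sets give equal
  values even at points of non-differentiability.\<close>

lemma partial_cong:
  assumes "open D" "u \<in> D" "\<And>v. v \<in> D \<Longrightarrow> f v = g v"
  shows "partial i f u = partial i g u"
proof -
  have "(f has_derivative f') (at u) \<longleftrightarrow> (g has_derivative f') (at u)" for f'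
    using assms has_derivative_transform_within_open[of f f' u UNIV D g]
      has_derivative_transform_within_open[of g f' u UNIV D f] by auto
  then show ?thesis
    by (simp add: partial_def frechet_derivative_def)
qed

lemma frechet_derivative_partial:
  fixes f :: "real^2 \<Rightarrow> 'b::real_normed_vector"
  assumes "f differentiable (at u)"
  shows "(f has_derivative (\<lambda>h. (h $ 1) *\<^sub>R partial 1 f u + (h $ 2) *\<^sub>R partial 2 f u)) (at u)"
proof -
  have f: "(f has_derivative frechet_derivative f (at u)) (at u)"
    using assms by (simp add: frechet_derivative_works)
  then interpret linear "frechet_derivative f (at u)"
    by (rule has_derivative_linear)
  have "frechet_derivative f (at u) h = (h $ 1) *\<^sub>R partial 1 f u + (h $ 2) *\<^sub>R partial 2 f u" for h
  proof -
    have "h = (h $ 1) *\<^sub>R axis 1 1 + (h $ 2) *\<^sub>R axis 2 1"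
      by (simp add: vec_eq_iff forall_2 axis_def)
    then show ?thesis
      unfolding partial_def by (metis add scale)
  qed
  then show ?thesis
    using f by (metis (no_types, lifting) ext)
qed

lemma has_derivative_along_line:
  fixes f :: "real^2 \<Rightarrow> real"
  assumes "f differentiable (at (u + t *\<^sub>R e))"
  shows "((\<lambda>s. f (u + s *\<^sub>R e)) has_real_derivative
           e $ 1 * partial 1 f (u + t *\<^sub>R e) + e $ 2 * partial 2 f (u + t *\<^sub>R e)) (at t)"
proof -
  have "((\<lambda>s. u + s *\<^sub>R e) has_derivative (\<lambda>s. s *\<^sub>R e)) (at t)"
    by (auto intro!: derivative_eq_intros)
  from diff_chain_at[OF this frechet_derivative_partial[OF assms]]
  show ?thesis
    unfolding has_field_derivative_def o_def
    by (elim back_subst[where P = "\<lambda>F. (_ has_derivative F) _"])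
      (auto simp: fun_eq_iff algebra_simps)
qed

lemma Ck_on_cong:
  assumes "open D" "\<And>v. v \<in> D \<Longrightarrow> f v = g v" "Ck_on k f D"
  shows "Ck_on k g D"
  using assms(2,3)
proof (induction k arbitrary: f g)
  case 0
  then show ?case
    by (metis Ck_on.simps(1) continuous_on_cong)
next
  case (Suc k)
  have "g differentiable (at u)" if u: "u \<in> D" for u
  proof -
    obtain f' where "(f has_derivative f') (at u)"
      using Suc.prems u by (auto simp: differentiable_def)
    then have "(g has_derivative f') (at u)"
      using has_derivative_transform_within_open[of f f' u UNIV D g] assms(1) u Suc.prems(1) by simp
    then show ?thesis
      by (auto simp: differentiable_def)
  qed
  moreover have "Ck_on k (partial i g) D" for i
    by (rule Suc.IH[of "partial i f"]) (use Suc.prems in \<open>auto intro: partial_cong[OF assms(1)]\<close>)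
  ultimately show ?case
    by simp
qed

lemma Ck_on_imp_continuous_on: "Ck_on k f D \<Longrightarrow> continuous_on D f"
  by (cases k) (auto simp: continuous_at_imp_continuous_on differentiable_imp_continuous_within)

lemma Ck_on_mono: "Ck_on k f D \<Longrightarrow> l \<le> k \<Longrightarrow> Ck_on l f D"
proof (induction l arbitrary: k f)
  case 0
  then show ?case
    using Ck_on_imp_continuous_on by auto
next
  case (Suc l)
  then obtain m where "k = Suc m" "l \<le> m"
    by (cases k) auto
  then show ?case
    using Suc by auto
qed

lemma Ck_on_subset: "Ck_on k f D \<Longrightarrow> E \<subseteq> D \<Longrightarrow> Ck_on k f E"
  by (induction k arbitrary: f) (auto intro: continuous_on_subset)

lemma Ck_on_imp_differentiable: "Ck_on k f D \<Longrightarrow> 0 < k \<Longrightarrow> u \<in> D \<Longrightarrow> f differentiable (at u)"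
  by (cases k) auto

lemma Ck_on_partial: "Ck_on (Suc k) f D \<Longrightarrow> Ck_on k (partial i f) D"
  by simp

text \<open>Needed for the unit normal, whose explicit formula contains a sign that is only locally
  constant.\<close>

lemma Ck_on_local:
  assumes "\<And>u. u \<in> D \<Longrightarrow> \<exists>E. open E \<and> u \<in> E \<and> Ck_on k f E"
  shows "Ck_on k f D"
  using assms
proof (induction k arbitrary: f)
  case 0
  have "continuous (at u) f" if "u \<in> D" for u
    using 0[OF that] by (auto simp: continuous_on_eq_continuous_at)
  then show ?case
    by (simp add: continuous_at_imp_continuous_on)
next
  case (Suc k)
  show ?case
    unfolding Ck_on.simps
  proof (intro conjI ballI allI)
    show "f differentiable (at u)" if "u \<in> D" for u
      using Suc.prems[OF that] by auto
    show "Ck_on k (partial i f) D" for i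
      by (rule Suc.IH) (use Suc.prems in fastforce)
  qed
qed

lemma Ck_on_const: "Ck_on k (\<lambda>u. c) D"
proof (induction k arbitrary: c)
  case (Suc k)
  have "partial i (\<lambda>u. c) = (\<lambda>u. 0)" for i
    by (simp add: partial_def fun_eq_iff)
  then show ?case
    using Suc by simp
qed simp

section \<open>Differentiation rules and closure properties of the classes C^k\<close>

lemma partial_add:
  assumes "f differentiable (at u)" "g differentiable (at u)"
  shows "partial i (\<lambda>v. f v + g v) u = partial i f u + partial i g u"
  using partial_eqI[OF has_derivative_add[OF assms[unfolded frechet_derivative_works]]]
  by (simp add: partial_def)

lemma (in bounded_linear) partial:
  assumes "g differentiable (at u)"
  shows "partial i (\<lambda>v. f (g v)) u = f (partial i g u)"
  using partial_eqI[OF has_derivative[OF assms[unfolded frechet_derivative_works]]]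
  by (simp add: partial_def)

lemma (in bounded_bilinear) partial:
  assumes "f differentiable (at u)" "g differentiable (at u)"
  shows "partial i (\<lambda>v. prod (f v) (g v)) u = prod (f u) (partial i g u) + prod (partial i f u) (g u)"
  using partial_eqI[OF FDERIV[OF assms[unfolded frechet_derivative_works]]]
  by (simp add: partial_def)

lemma (in bounded_bilinear) differentiable:
  assumes "f differentiable (at u)" "g differentiable (at u)"
  shows "(\<lambda>v. prod (f v) (g v)) differentiable (at u)"
  using assms FDERIV unfolding differentiable_def by blast

lemma partial_DERIV:
  assumes "f differentiable (at u)" "(\<psi> has_real_derivative d) (at (f u))"
  shows "partial i (\<lambda>v. \<psi> (f v)) u = d * partial i f u"
proof -
  have "((\<lambda>v. \<psi> (f v)) has_derivative (\<lambda>h. d * frechet_derivative f (at u) h)) (at u)"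
    using diff_chain_at[OF assms(1)[unfolded frechet_derivative_works] assms(2)[unfolded has_field_derivative_def]]
    by (simp add: o_def)
  from partial_eqI[OF this] show ?thesis
    by (simp add: partial_def)
qed

lemma Ck_on_add:
  assumes "open D" "Ck_on k f D" "Ck_on k g D"
  shows "Ck_on k (\<lambda>u. f u + g u) D"
  using assms(2,3)
proof (induction k arbitrary: f g)
  case 0
  then show ?case
    by (auto intro: continuous_intros)
next
  case (Suc k)
  have "Ck_on k (partial i (\<lambda>u. f u + g u)) D" for i
    by (rule Ck_on_cong[OF assms(1) _ Suc.IH[of "partial i f" "partial i g"]])
      (use Suc.prems in \<open>auto simp: partial_add\<close>)
  then show ?case
    using Suc.prems by (auto intro: differentiable_add)
qed

lemma (in bounded_linear) Ck_on:
  assumes "open D" "Ck_on k g D"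
  shows "Ck_on k (\<lambda>u. f (g u)) D"
  using assms(2)
proof (induction k arbitrary: g)
  case 0
  then show ?case
    by (auto intro: continuous_on)
next
  case (Suc k)
  have "Ck_on k (partial i (\<lambda>u. f (g u))) D" for i
    by (rule Ck_on_cong[OF assms(1) _ Suc.IH[of "partial i g"]])
      (use Suc.prems in \<open>auto simp: partial\<close>)
  moreover have "(\<lambda>u. f (g u)) differentiable (at u)" if "u \<in> D" for u
    using Suc.prems that has_derivative by (force simp: differentiable_def)
  ultimately show ?case
    by auto
qed

lemma (in bounded_bilinear) Ck_on:
  assumes "open D" "Ck_on k f D" "Ck_on k g D"
  shows "Ck_on k (\<lambda>u. prod (f u) (g u)) D"
  using assms(2,3)
proof (induction k arbitrary: f g)
  case 0
  then show ?case
    by (auto intro: continuous_on)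
next
  case (Suc k)
  have "Ck_on k (partial i (\<lambda>u. prod (f u) (g u))) D" for i
  proof (rule Ck_on_cong[OF assms(1)])
    show "Ck_on k (\<lambda>u. prod (f u) (partial i g u) + prod (partial i f u) (g u)) D"
      using Suc.prems by (intro Ck_on_add assms(1) Suc.IH) (auto intro: Ck_on_mono[of "Suc k"])
  qed (use Suc.prems in \<open>auto simp: partial\<close>)
  then show ?case
    using Suc.prems by (auto intro: differentiable)
qed

lemmas Ck_on_mult = bounded_bilinear.Ck_on[OF bounded_bilinear_mult]
lemmas Ck_on_scaleR = bounded_bilinear.Ck_on[OF bounded_bilinear_scaleR]
lemmas Ck_on_inner = bounded_bilinear.Ck_on[OF bounded_bilinear_inner]
lemmas partial_mult = bounded_bilinear.partial[OF bounded_bilinear_mult]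
lemmas partial_inner = bounded_bilinear.partial[OF bounded_bilinear_inner]

lemma Ck_on_minus: "open D \<Longrightarrow> Ck_on k f D \<Longrightarrow> Ck_on k (\<lambda>u. - f u) D"
  by (rule bounded_linear.Ck_on[OF bounded_linear_minus[OF bounded_linear_ident]])

lemma Ck_on_diff:
  assumes "open D" "Ck_on k f D" "Ck_on k g D"
  shows "Ck_on k (\<lambda>u. f u - g u) D"
  using Ck_on_add[OF assms(1,2) Ck_on_minus[OF assms(1,3)]] by simp

lemma differentiable_powr_const:
  fixes f :: "'b::real_normed_vector \<Rightarrow> real"
  assumes "f differentiable (at u)" "f u > 0"
  shows "(\<lambda>v. f v powr a) differentiable (at u)"
proof -
  have "((\<lambda>x. x powr a) has_derivative (\<lambda>h. (a * f u powr (a - 1)) * h)) (at (f u))"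
    using has_real_derivative_powr[OF assms(2), of a] by (simp add: has_field_derivative_def)
  from diff_chain_at[OF assms(1)[unfolded frechet_derivative_works] this] show ?thesis
    by (auto simp: differentiable_def o_def)
qed

text \<open>Differentiation lowers the exponent, so the induction runs over all exponents at once.
  Reciprocals and the normalizing factor of the unit normal are the cases -1 and -1/2.\<close>

lemma Ck_on_powr:
  fixes f :: "real^2 \<Rightarrow> real"
  assumes "open D" "Ck_on k f D" "\<And>u. u \<in> D \<Longrightarrow> f u > 0"
  shows "Ck_on k (\<lambda>u. f u powr a) D"
  using assms(2)
proof (induction k arbitrary: a)
  case 0
  then show ?case
    by (auto intro!: continuous_intros dest!: assms(3))
next
  case (Suc k)
  have "Ck_on k (partial i (\<lambda>u. f u powr a)) D" for i
  proof (rule Ck_on_cong[OF assms(1)])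
    show "Ck_on k (\<lambda>u. (a * f u powr (a - 1)) * partial i f u) D"
      using Suc.prems by (intro Ck_on_mult Ck_on_const assms(1) Suc.IH) (auto intro: Ck_on_mono[of "Suc k"])
    show "(a * f u powr (a - 1)) * partial i f u = partial i (\<lambda>u. f u powr a) u" if "u \<in> D" for u
      using partial_DERIV[where f = f and u = u, OF _ has_real_derivative_powr[OF assms(3)[OF that], of a], of i] Suc.prems that
      by simp
  qed
  then show ?case
    using Suc.prems assms(3) by (auto intro: differentiable_powr_const)
qed

lemma Ck_on_inverse:
  fixes f :: "real^2 \<Rightarrow> real"
  assumes "open D" "Ck_on k f D" "\<And>u. u \<in> D \<Longrightarrow> f u > 0"
  shows "Ck_on k (\<lambda>u. inverse (f u)) D"
  by (rule Ck_on_cong[OF assms(1) _ Ck_on_powr[OF assms, of "-1"]])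
    (use assms(3) in \<open>simp_all add: powr_minus less_imp_le\<close>)

lemma Ck_on_ln:
  fixes f :: "real^2 \<Rightarrow> real"
  assumes "open D" "Ck_on k f D" "\<And>u. u \<in> D \<Longrightarrow> f u > 0"
  shows "Ck_on k (\<lambda>u. ln (f u)) D"
proof (cases k)
  case 0
  then show ?thesis
    using assms by (auto intro!: continuous_intros dest!: assms(3))
next
  case (Suc l)
  have "Ck_on l (partial i (\<lambda>u. ln (f u))) D" for i
  proof (rule Ck_on_cong[OF assms(1)])
    show "Ck_on l (\<lambda>u. inverse (f u) * partial i f u) D"
      using assms Suc by (intro Ck_on_mult Ck_on_inverse) (auto intro: Ck_on_mono[of "Suc l"])
    show "inverse (f u) * partial i f u = partial i (\<lambda>u. ln (f u)) u" if "u \<in> D" for u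
      using partial_DERIV[where f = f and u = u, OF _ DERIV_ln[OF assms(3)[OF that]], of i] assms(2) Suc that by simp
  qed
  moreover have "(\<lambda>u. ln (f u)) differentiable (at u)" if "u \<in> D" for u
    using Ck_on_imp_differentiable[OF assms(2) _ that] assms(3)[OF that] Suc
    unfolding differentiable_def by (auto intro: has_derivative_ln)
  ultimately show ?thesis
    using Suc by simp
qed

section \<open>Second derivatives\<close>

lemma partial_commute:
  fixes f :: "real^2 \<Rightarrow> real"
  assumes "open D" "Ck_on 2 f D" "u \<in> D"
  shows "partial 1 (partial 2 f) u = partial 2 (partial 1 f) u"
proof (rule ccontr)
  let ?a = "axis 1 1 :: real^2" and ?b = "axis 2 1 :: real^2"
  let ?P = "partial 1 (partial 2 f)" and ?Q = "partial 2 (partial 1 f)"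
  assume ne: "?P u \<noteq> ?Q u"
  \<comment> \<open>Half of the assumed gap: no number lies within \<epsilon> of both
    \<open>?P u\<close> and \<open>?Q u\<close>.\<close>
  define \<epsilon> where "\<epsilon> = dist (?P u) (?Q u) / 2"
  have "\<epsilon> > 0"
    using ne by (simp add: \<epsilon>_def)
  have C: "Ck_on (Suc (Suc 0)) f D"
    using assms(2) by (simp only: numeral_2_eq_2)
  then have diff: "f differentiable (at v)" "partial i f differentiable (at v)" if "v \<in> D" for v i
    using that by auto
  have "continuous_on D ?P" "continuous_on D ?Q"
    using C by simp_all
  then have "isCont ?P u" "isCont ?Q u"
    using assms(1,3) continuous_on_eq_continuous_at by blast+
  then have "\<exists>d>0. \<forall>v. dist v u < d \<longrightarrow> dist (?P v) (?P u) < \<epsilon>"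
    "\<exists>d>0. \<forall>v. dist v u < d \<longrightarrow> dist (?Q v) (?Q u) < \<epsilon>"
    using \<open>\<epsilon> > 0\<close> unfolding continuous_at_eps_delta by simp_all
  then obtain d1 d2 where d: "d1 > 0" "\<forall>v. dist v u < d1 \<longrightarrow> dist (?P v) (?P u) < \<epsilon>"
      "d2 > 0" "\<forall>v. dist v u < d2 \<longrightarrow> dist (?Q v) (?Q u) < \<epsilon>"
    by auto
  obtain d3 where d3: "d3 > 0" "ball u d3 \<subseteq> D"
    using assms(1,3) open_contains_ball by blast
  \<comment> \<open>A point of the square of side t at u is at distance at most 2 t < 3 t from u,
    hence within all three radii.\<close>
  define t where "t = min d1 (min d2 d3) / 3"
  have "t > 0"
    using d d3 by (simp add: t_def)
  have near: "dist (u + r *\<^sub>R ?a + s *\<^sub>R ?b) u < min d1 (min d2 d3)" if "0 \<le> r" "r \<le> t" "0 \<le> s" "s \<le> t" for r s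
  proof -
    have "norm (r *\<^sub>R ?a + s *\<^sub>R ?b) \<le> r + s"
      using norm_triangle_ineq[of "r *\<^sub>R ?a" "s *\<^sub>R ?b"] that by (simp add: norm_axis_1)
    also have "\<dots> < 3 * t"
      using that \<open>t > 0\<close> by simp
    finally show ?thesis
      by (simp add: dist_norm t_def algebra_simps)
  qed
  have inD: "u + r *\<^sub>R ?a + s *\<^sub>R ?b \<in> D" if "0 \<le> r" "r \<le> t" "0 \<le> s" "s \<le> t" for r s
    using near[OF that] d3(2) by (auto simp: dist_commute)
  have da: "((\<lambda>r. g (u + r *\<^sub>R ?a + s *\<^sub>R ?b)) has_real_derivative partial 1 g (u + r *\<^sub>R ?a + s *\<^sub>R ?b)) (at r)"
    if "g differentiable (at (u + r *\<^sub>R ?a + s *\<^sub>R ?b))" for g :: "real^2 \<Rightarrow> real" and r s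
    using has_derivative_along_line[of g "u + s *\<^sub>R ?b" r ?a] that by (simp add: add_ac axis_def)
  have db: "((\<lambda>s. g (u + r *\<^sub>R ?a + s *\<^sub>R ?b)) has_real_derivative partial 2 g (u + r *\<^sub>R ?a + s *\<^sub>R ?b)) (at s)"
    if "g differentiable (at (u + r *\<^sub>R ?a + s *\<^sub>R ?b))" for g :: "real^2 \<Rightarrow> real" and r s
    using has_derivative_along_line[of g "u + r *\<^sub>R ?a" s ?b] that by (simp add: add_ac axis_def)
  \<comment> \<open>The second difference over the corners of the square. Two mean value steps,
    taken in either order, turn it into t * t times \<open>?Q\<close> at one point and t * t times
    \<open>?P\<close> at another.\<close>
  define \<Delta> where "\<Delta> = f (u + t *\<^sub>R ?a + t *\<^sub>R ?b) - f (u + t *\<^sub>R ?a) - f (u + t *\<^sub>R ?b) + f u"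
  have "\<exists>r>0. r < t \<and> (f (u + t *\<^sub>R ?a + t *\<^sub>R ?b) - f (u + t *\<^sub>R ?a + 0 *\<^sub>R ?b))
      - (f (u + 0 *\<^sub>R ?a + t *\<^sub>R ?b) - f (u + 0 *\<^sub>R ?a + 0 *\<^sub>R ?b))
      = (t - 0) * (partial 1 f (u + r *\<^sub>R ?a + t *\<^sub>R ?b) - partial 1 f (u + r *\<^sub>R ?a + 0 *\<^sub>R ?b))"
    by (rule MVT2[OF \<open>t > 0\<close>]) (intro DERIV_diff da diff inD; use \<open>t > 0\<close> in simp)
  then obtain r where r: "0 < r" "r < t"
      "\<Delta> = t * (partial 1 f (u + r *\<^sub>R ?a + t *\<^sub>R ?b) - partial 1 f (u + r *\<^sub>R ?a + 0 *\<^sub>R ?b))"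
    by (auto simp: \<Delta>_def)
  have "\<exists>s>0. s < t \<and> partial 1 f (u + r *\<^sub>R ?a + t *\<^sub>R ?b) - partial 1 f (u + r *\<^sub>R ?a + 0 *\<^sub>R ?b)
      = (t - 0) * ?Q (u + r *\<^sub>R ?a + s *\<^sub>R ?b)"
    by (rule MVT2[OF \<open>t > 0\<close>]) (intro db diff inD; use r in simp)
  then obtain s where s: "0 < s" "s < t" "\<Delta> = t * (t * ?Q (u + r *\<^sub>R ?a + s *\<^sub>R ?b))"
    using r(3) by auto
  have "\<exists>r>0. r < t \<and> (f (u + t *\<^sub>R ?a + t *\<^sub>R ?b) - f (u + 0 *\<^sub>R ?a + t *\<^sub>R ?b))
      - (f (u + t *\<^sub>R ?a + 0 *\<^sub>R ?b) - f (u + 0 *\<^sub>R ?a + 0 *\<^sub>R ?b))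
      = (t - 0) * (partial 2 f (u + t *\<^sub>R ?a + r *\<^sub>R ?b) - partial 2 f (u + 0 *\<^sub>R ?a + r *\<^sub>R ?b))"
    by (rule MVT2[OF \<open>t > 0\<close>]) (intro DERIV_diff db diff inD; use \<open>t > 0\<close> in simp)
  then obtain r' where r': "0 < r'" "r' < t"
      "\<Delta> = t * (partial 2 f (u + t *\<^sub>R ?a + r' *\<^sub>R ?b) - partial 2 f (u + 0 *\<^sub>R ?a + r' *\<^sub>R ?b))"
    by (auto simp: \<Delta>_def)
  have "\<exists>s>0. s < t \<and> partial 2 f (u + t *\<^sub>R ?a + r' *\<^sub>R ?b) - partial 2 f (u + 0 *\<^sub>R ?a + r' *\<^sub>R ?b)
      = (t - 0) * ?P (u + s *\<^sub>R ?a + r' *\<^sub>R ?b)"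
    by (rule MVT2[OF \<open>t > 0\<close>]) (intro da diff inD; use r' in simp)
  then obtain s' where s': "0 < s'" "s' < t" "\<Delta> = t * (t * ?P (u + s' *\<^sub>R ?a + r' *\<^sub>R ?b))"
    using r'(3) by auto
  have "?P (u + s' *\<^sub>R ?a + r' *\<^sub>R ?b) = ?Q (u + r *\<^sub>R ?a + s *\<^sub>R ?b)"
    using s(3) s'(3) \<open>t > 0\<close> by simp
  moreover have "dist (?P (u + s' *\<^sub>R ?a + r' *\<^sub>R ?b)) (?P u) < \<epsilon>"
    by (rule d(2)[rule_format]) (use near[of s' r'] s' r' in linarith)
  moreover have "dist (?Q (u + r *\<^sub>R ?a + s *\<^sub>R ?b)) (?Q u) < \<epsilon>"
    by (rule d(4)[rule_format]) (use near[of r s] s r in linarith)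
  ultimately show False
    unfolding \<epsilon>_def by (metis dist_triangle_half_r less_irrefl)
qed

text \<open>If k were positive, \<phi>' would be positive just to the right of its zero at 0, and by
  the mean value theorem \<phi> would exceed \<phi> 0 there.\<close>

lemma second_derivative_at_max:
  fixes \<phi> :: "real \<Rightarrow> real"
  assumes "d > 0" "\<And>t. \<bar>t\<bar> < d \<Longrightarrow> (\<phi> has_real_derivative \<phi>' t) (at t)"
    and "(\<phi>' has_real_derivative k) (at 0)" "\<And>t. \<bar>t\<bar> < d \<Longrightarrow> \<phi> t \<le> \<phi> 0"
  shows "\<phi>' 0 = 0" "k \<le> 0"
proof -
  show *: "\<phi>' 0 = 0"
    using DERIV_local_max[of \<phi> "\<phi>' 0" 0 d] assms(1,2,4) by simp
  show "k \<le> 0"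
  proof (rule ccontr)
    assume "\<not> k \<le> 0"
    then obtain e where e: "e > 0" "\<And>h. h > 0 \<Longrightarrow> h < e \<Longrightarrow> \<phi>' 0 < \<phi>' h"
      using has_real_derivative_pos_inc_right[OF assms(3)[unfolded has_field_derivative_def[symmetric]]] by auto
    define t where "t = min d e / 2"
    have t: "0 < t" "t < d" "t < e"
      using assms(1) e(1) by (auto simp: t_def)
    obtain z where "0 < z" "z < t" "\<phi> t - \<phi> 0 = (t - 0) * \<phi>' z"
      using MVT2[OF t(1), of \<phi> \<phi>'] assms(2) t by force
    then show False
      using e(2)[of z] * t assms(4)[of t] by (smt (verit) mult_pos_pos)
  qed
qed

text \<open>With P, Q, R, T as the entries of a Hessian, the first bracket is the second derivative
  in the direction (1, b / a), and T is the one along the second axis.\<close>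

lemma complete_square:
  fixes a b c P Q R T :: real
  assumes "a \<noteq> 0"
  shows "a * (P + (b / a) * Q + (b / a) * (R + (b / a) * T)) + (a * c - b * b) / a * T
    = a * P + b * Q + b * R + c * T"
  using assms by (simp add: field_simps)

text \<open>On every line through p the function has a maximum at p, so all directional second
  derivatives are nonpositive; by \<open>complete_square\<close> the operator is a combination of
  two of them with positive weights a and (a * c - b * b) / a.\<close>

lemma elliptic_operator_at_max:
  fixes f :: "real^2 \<Rightarrow> real"
  assumes "open D" "Ck_on 2 f D" "p \<in> D" "\<And>v. v \<in> D \<Longrightarrow> f v \<le> f p"
    and "a > 0" "a * c - b * b > 0"
  shows "partial i f p = 0"
    and "a * partial 1 (partial 1 f) p + b * partial 2 (partial 1 f) p
       + b * partial 1 (partial 2 f) p + c * partial 2 (partial 2 f) p \<le> 0"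
proof -
  have C: "Ck_on (Suc (Suc 0)) f D"
    using assms(2) by (simp only: numeral_2_eq_2)
  have diff: "f differentiable (at v)" "partial i f differentiable (at v)" if "v \<in> D" for v i
    using C that by auto
  have line: "e $ 1 * partial 1 f p + e $ 2 * partial 2 f p = 0 \<and>
    e $ 1 * (e $ 1 * partial 1 (partial 1 f) p + e $ 2 * partial 2 (partial 1 f) p)
    + e $ 2 * (e $ 1 * partial 1 (partial 2 f) p + e $ 2 * partial 2 (partial 2 f) p) \<le> 0" for e :: "real^2"
  proof -
    have "open ((\<lambda>t. p + t *\<^sub>R e) -` D)"
      by (rule open_vimage[OF assms(1)]) (auto intro!: continuous_intros)
    moreover have "0 \<in> (\<lambda>t. p + t *\<^sub>R e) -` D"
      using assms(3) by simp
    ultimately obtain d where "d > 0" "ball 0 d \<subseteq> (\<lambda>t. p + t *\<^sub>R e) -` D"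
      using open_contains_ball by blast
    then have d: "d > 0" "\<And>t. \<bar>t\<bar> < d \<Longrightarrow> p + t *\<^sub>R e \<in> D"
      by (auto simp: subset_eq)
    let ?\<phi>' = "\<lambda>t. e $ 1 * partial 1 f (p + t *\<^sub>R e) + e $ 2 * partial 2 f (p + t *\<^sub>R e)"
    have 1: "((\<lambda>t. f (p + t *\<^sub>R e)) has_real_derivative ?\<phi>' t) (at t)" if "\<bar>t\<bar> < d" for t
      by (rule has_derivative_along_line) (use d that diff in auto)
    have 2: "(?\<phi>' has_real_derivative
       e $ 1 * (e $ 1 * partial 1 (partial 1 f) p + e $ 2 * partial 2 (partial 1 f) p)
       + e $ 2 * (e $ 1 * partial 1 (partial 2 f) p + e $ 2 * partial 2 (partial 2 f) p)) (at 0)"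
      using has_derivative_along_line[of "partial 1 f" p 0 e] has_derivative_along_line[of "partial 2 f" p 0 e]
        diff[OF assms(3)] by (intro DERIV_add DERIV_cmult) simp_all
    show ?thesis
      using second_derivative_at_max[of d, OF d(1) 1 2] assms(4) d(2) by simp
  qed
  show "partial i f p = 0"
  proof -
    consider "i = 1" | "i = 2"
      using exhaust_2 by blast
    then show ?thesis
      by cases (use line[of "axis 1 1"] line[of "axis 2 1"] in \<open>simp_all add: axis_def\<close>)
  qed
  let ?e = "axis 1 1 + (b / a) *\<^sub>R axis 2 1 :: real^2"
  have "?e $ 1 = 1" "?e $ 2 = b / a"
    by (simp_all add: axis_def)
  then have X: "partial 1 (partial 1 f) p + (b / a) * partial 2 (partial 1 f) p
    + (b / a) * (partial 1 (partial 2 f) p + (b / a) * partial 2 (partial 2 f) p) \<le> 0"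
    using line[of ?e] by (simp only: mult_1)
  have Y: "partial 2 (partial 2 f) p \<le> 0"
    using line[of "axis 2 1"] by (simp add: axis_def)
  have "a * (partial 1 (partial 1 f) p + (b / a) * partial 2 (partial 1 f) p
    + (b / a) * (partial 1 (partial 2 f) p + (b / a) * partial 2 (partial 2 f) p))
    + (a * c - b * b) / a * partial 2 (partial 2 f) p \<le> 0"
    by (rule add_nonpos_nonpos[OF mult_nonneg_nonpos[OF _ X] mult_nonneg_nonpos[OF _ Y]])
      (use assms(5,6) in simp_all)
  also have "a * (partial 1 (partial 1 f) p + (b / a) * partial 2 (partial 1 f) p
    + (b / a) * (partial 1 (partial 2 f) p + (b / a) * partial 2 (partial 2 f) p))
    + (a * c - b * b) / a * partial 2 (partial 2 f) p =
    a * partial 1 (partial 1 f) p + b * partial 2 (partial 1 f) p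
       + b * partial 1 (partial 2 f) p + c * partial 2 (partial 2 f) p"
    by (rule complete_square) (use assms(5) in simp)
  finally show "a * partial 1 (partial 1 f) p + b * partial 2 (partial 1 f) p
       + b * partial 1 (partial 2 f) p + c * partial 2 (partial 2 f) p \<le> 0" .
qed

lemma partial_const [simp]: "partial i (\<lambda>u. c) u = 0"
  by (simp add: partial_def)

lemma partial_cmult:
  fixes f :: "real^2 \<Rightarrow> real"
  assumes "f differentiable (at u)"
  shows "partial i (\<lambda>v. c * f v) u = c * partial i f u"
  using assms by (simp add: partial_mult)

lemma partial_diff:
  assumes "f differentiable (at u)" "g differentiable (at u)"
  shows "partial i (\<lambda>v. f v - g v) u = partial i f u - partial i g u"
  using partial_eqI[OF has_derivative_diff[OF assms[unfolded frechet_derivative_works]]]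
  by (simp add: partial_def)

section \<open>The curvature of conformal metrics on surfaces\<close>

lemma invertible_matrix_inv:
  fixes A :: "real^'n^'n"
  assumes "det A \<noteq> 0"
  shows "A ** matrix_inv A = mat 1" "matrix_inv A ** A = mat 1"
proof -
  have "invertible A"
    using assms by (simp add: invertible_det_nz)
  then show "A ** matrix_inv A = mat 1" "matrix_inv A ** A = mat 1"
    unfolding invertible_def matrix_inv_def by (metis (mono_tags, lifting) someI_ex)+
qed

lemma matrix_inv_2:
  fixes A :: "real^2^2"
  assumes "det A \<noteq> 0"
  shows "matrix_inv A $ 1 $ 1 = A $ 2 $ 2 * inverse (det A)" "matrix_inv A $ 1 $ 2 = - A $ 1 $ 2 * inverse (det A)"
    "matrix_inv A $ 2 $ 1 = - A $ 2 $ 1 * inverse (det A)" "matrix_inv A $ 2 $ 2 = A $ 1 $ 1 * inverse (det A)"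
proof -
  \<comment> \<open>The adjugate divided by the determinant: the diagonal is swapped, the
    off-diagonal entries change sign.\<close>
  define B :: "real^2^2" where
    "B = (\<chi> i j. (if i = j then (if i = 1 then A $ 2 $ 2 else A $ 1 $ 1) else - A $ i $ j) * inverse (det A))"
  have B: "B $ 1 $ 1 = A $ 2 $ 2 * inverse (det A)" "B $ 1 $ 2 = - A $ 1 $ 2 * inverse (det A)"
    "B $ 2 $ 1 = - A $ 2 $ 1 * inverse (det A)" "B $ 2 $ 2 = A $ 1 $ 1 * inverse (det A)"
    by (simp_all add: B_def)
  have "(A ** B) $ i $ j = mat 1 $ i $ j" for i j
  proof -
    have "(A ** B) $ 1 $ 1 = det A * inverse (det A)" "(A ** B) $ 1 $ 2 = 0"
      "(A ** B) $ 2 $ 1 = 0" "(A ** B) $ 2 $ 2 = det A * inverse (det A)"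
      unfolding matrix_matrix_mult_def by (simp_all add: sum_2 B) (simp_all add: det_2 algebra_simps)
    then show ?thesis
      using assms exhaust_2[of i] exhaust_2[of j] by (auto simp: mat_def)
  qed
  then have "A ** B = mat 1"
    by (simp add: vec_eq_iff)
  then have "matrix_inv A = B"
    by (metis assms invertible_matrix_inv(2) matrix_mul_assoc matrix_mul_lid matrix_mul_rid)
  then show "matrix_inv A $ 1 $ 1 = A $ 2 $ 2 * inverse (det A)" "matrix_inv A $ 1 $ 2 = - A $ 1 $ 2 * inverse (det A)"
    "matrix_inv A $ 2 $ 1 = - A $ 2 $ 1 * inverse (det A)" "matrix_inv A $ 2 $ 2 = A $ 1 $ 1 * inverse (det A)"
    using B by simp_all
qed

lemma det_scaleR_2: "det (c *\<^sub>R A) = c\<^sup>2 * det A" for A :: "real^2^2"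
  by (simp add: det_2 power2_eq_square algebra_simps)

lemma matrix_inv_scaleR_2:
  fixes A :: "real^2^2"
  assumes "det A \<noteq> 0" "c \<noteq> 0"
  shows "matrix_inv (c *\<^sub>R A) = inverse c *\<^sub>R matrix_inv A"
  using assms
  by (simp add: vec_eq_iff forall_2 matrix_inv_2 det_scaleR_2 power2_eq_square field_simps)

lemma christoffel_cong:
  assumes "open D" "u \<in> D" "\<And>v. v \<in> D \<Longrightarrow> g v = g' v"
  shows "christoffel g k i j u = christoffel g' k i j u"
proof -
  have "partial i (\<lambda>v. g v $ j $ l) u = partial i (\<lambda>v. g' v $ j $ l) u" for i j l
    by (rule partial_cong[OF assms(1,2)]) (simp add: assms(3))
  then show ?thesis
    using assms(2,3) by (simp add: christoffel_def)
qed

text \<open>Curvature is local. This matters because functions read in a chart are only controlled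
  on the image of the chart, so formulas for the relative metrics hold there and nowhere
  else.\<close>

lemma scalar_curvature_cong:
  assumes "open D" "u \<in> D" "\<And>v. v \<in> D \<Longrightarrow> g v = g' v"
  shows "scalar_curvature g u = scalar_curvature g' u"
proof -
  have C: "christoffel g k i j v = christoffel g' k i j v" if "v \<in> D" for k i j v
    using that assms(3) by (rule christoffel_cong[OF assms(1)])
  then have "partial m (christoffel g k i j) u = partial m (christoffel g' k i j) u" for m k i j
    by (rule partial_cong[OF assms(1,2)])
  then show ?thesis
    using C[OF assms(2)] assms(2,3) by (simp add: scalar_curvature_def ricci_def)
qed

text \<open>The pointwise content of the conformal change $g \mapsto e^\mu g$: $m$, $P$ are the metric and its
  first derivatives, $G$ its Christoffel symbols, $T$ their increment with derivatives $Q$, and $W$ the gradient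
  of $\mu$ with derivatives $V$. Expressing everything through $m$, $G$, $W$, $V$ turns the claim
  into a polynomial identity.\<close>

lemma conformal_trace:
  fixes m V H E :: "2 \<Rightarrow> 2 \<Rightarrow> real" and W \<mu> :: "2 \<Rightarrow> real"
    and G P T :: "2 \<Rightarrow> 2 \<Rightarrow> 2 \<Rightarrow> real" and Q :: "2 \<Rightarrow> 2 \<Rightarrow> 2 \<Rightarrow> 2 \<Rightarrow> real"
  assumes m: "m 2 1 = m 1 2" and G: "\<And>k. G k 2 1 = G k 1 2"
    and P: "\<And>k i j. P k i j = (\<Sum>l\<in>UNIV. m l j * G l k i + m i l * G l k j)"
    and \<mu>: "\<And>i. \<mu> i = (\<Sum>l\<in>UNIV. m i l * W l)"
    and H: "\<And>j i. H j i = (\<Sum>l\<in>UNIV. m i l * V j l + P j i l * W l)"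
    and T: "\<And>k i j. T k i j = 1/2 * ((if k = j then \<mu> i else 0) + (if k = i then \<mu> j else 0) - m i j * W k)"
    and Q: "\<And>n k i j. Q n k i j = 1/2 * ((if k = j then H n i else 0) + (if k = i then H n j else 0)
      - (m i j * V n k + P n i j * W k))"
    and E: "\<And>i j. E i j = (\<Sum>k\<in>UNIV. Q k k i j - Q j k i k)
      + (\<Sum>k\<in>UNIV. \<Sum>l\<in>UNIV. G k k l * T l i j + T k k l * (G l i j + T l i j)
           - G k j l * T l i k - T k j l * (G l i k + T l i k))
      + (H j i - (\<Sum>k\<in>UNIV. G k i j * \<mu> k))"
  shows "m 2 2 * E 1 1 - m 1 2 * (E 1 2 + E 2 1) + m 1 1 * E 2 2 = 0"
proof -
  define a b c where abc: "a = m 1 1" "b = m 1 2" "c = m 2 2"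
  define w1 w2 where w: "w1 = W 1" "w2 = W 2"
  have T': "T 1 1 1 = a * w1 / 2 + b * w2" "T 2 1 1 = - a * w2 / 2"
    "T 1 1 2 = c * w2 / 2" "T 2 1 2 = a * w1 / 2" "T 1 2 1 = c * w2 / 2" "T 2 2 1 = a * w1 / 2"
    "T 1 2 2 = - c * w1 / 2" "T 2 2 2 = b * w1 + c * w2 / 2"
    by (simp_all add: T \<mu> sum_2 m abc w field_simps)
  have \<mu>': "\<mu> 1 = a * w1 + b * w2" "\<mu> 2 = b * w1 + c * w2"
    by (simp_all add: \<mu> sum_2 m abc w)
  have Q': "Q k 1 1 1 = H k 1 - (a * V k 1 + P k 1 1 * w1) / 2"
    "Q k 2 1 1 = - (a * V k 2 + P k 1 1 * w2) / 2"
    "Q k 1 1 2 = (H k 2 - (b * V k 1 + P k 1 2 * w1)) / 2"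
    "Q k 2 1 2 = (H k 1 - (b * V k 2 + P k 1 2 * w2)) / 2"
    "Q k 1 2 1 = (H k 2 - (b * V k 1 + P k 2 1 * w1)) / 2"
    "Q k 2 2 1 = (H k 1 - (b * V k 2 + P k 2 1 * w2)) / 2"
    "Q k 1 2 2 = - (c * V k 1 + P k 2 2 * w1) / 2"
    "Q k 2 2 2 = H k 2 - (c * V k 2 + P k 2 2 * w2) / 2" for k
    by (simp_all add: Q m abc w field_simps)
  have P': "P k 1 1 = 2 * (a * G 1 k 1 + b * G 2 k 1)" "P k 2 2 = 2 * (b * G 1 k 2 + c * G 2 k 2)"
    "P k 1 2 = b * G 1 k 1 + c * G 2 k 1 + a * G 1 k 2 + b * G 2 k 2"
    "P k 2 1 = b * G 1 k 1 + c * G 2 k 1 + a * G 1 k 2 + b * G 2 k 2" for k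
    by (simp_all add: P sum_2 m abc)
  have H': "H j 1 = (a * V j 1 + P j 1 1 * w1) + (b * V j 2 + P j 1 2 * w2)"
    "H j 2 = (b * V j 1 + P j 2 1 * w1) + (c * V j 2 + P j 2 2 * w2)" for j
    by (simp_all add: H sum_2 m abc w)
  \<comment> \<open>Together with a, b, c, w1, w2 these are the independent variables: six symmetric
    Christoffel symbols and the four derivatives of the gradient. No inverse metric is left, so ring
    arithmetic decides the claim.\<close>
  define x1 x2 x3 y1 y2 y3 v11 v12 v21 v22 where
    xv: "x1 = G 1 1 1" "x2 = G 1 1 2" "x3 = G 1 2 2" "y1 = G 2 1 1" "y2 = G 2 1 2" "y3 = G 2 2 2"
      "v11 = V 1 1" "v12 = V 1 2" "v21 = V 2 1" "v22 = V 2 2"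
  show ?thesis
    unfolding E sum_2 T' \<mu>' Q' H' P' G xv[symmetric] abc[symmetric]
    by (simp add: algebra_simps add_divide_distrib diff_divide_distrib)
qed

text \<open>The Laplace-Beltrami operator as the trace of the covariant Hessian, which displays it
  directly as a second-order operator with a drift term. Passing from g to -g keeps the Christoffel
  symbols and reverses the sign of the operator.\<close>

definition laplacian :: "(real^2 \<Rightarrow> real^2^2) \<Rightarrow> (real^2 \<Rightarrow> real) \<Rightarrow> real^2 \<Rightarrow> real" where
  "laplacian g f u = (\<Sum>i\<in>UNIV. \<Sum>j\<in>UNIV. matrix_inv (g u) $ i $ j *
     (partial j (partial i f) u - (\<Sum>k\<in>UNIV. christoffel g k i j u * partial k f u)))"

text \<open>A positive determinant makes a symmetric 2x2 matrix definite but leaves the sign open,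
  so both orientations of the normal field are covered. Class C^2 is what makes the Christoffel
  symbols C^1 and the Ricci tensor meaningful.\<close>

locale metric_on =
  fixes D :: "(real^2) set" and g :: "real^2 \<Rightarrow> real^2^2"
  assumes open_D: "open D"
    and C2: "\<And>i j. Ck_on 2 (\<lambda>v. g v $ i $ j) D"
    and symmetric: "\<And>u. u \<in> D \<Longrightarrow> g u $ 2 $ 1 = g u $ 1 $ 2"
    and det_pos: "\<And>u. u \<in> D \<Longrightarrow> det (g u) > 0"
begin

lemma symmetric': "u \<in> D \<Longrightarrow> g u $ i $ j = g u $ j $ i"
  using symmetric exhaust_2[of i] exhaust_2[of j] by metis

lemma differentiable_entry: "u \<in> D \<Longrightarrow> (\<lambda>v. g v $ i $ j) differentiable (at u)"
  using Ck_on_imp_differentiable[OF C2] by simp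

lemma C1_partial: "Ck_on 1 (partial l (\<lambda>v. g v $ i $ j)) D"
  using C2[of i j] by (simp add: numeral_2_eq_2)

lemma C1: "Ck_on 1 (\<lambda>v. g v $ i $ j) D"
  using C2[of i j] by (rule Ck_on_mono) simp

lemma C1_inverse_det: "Ck_on 1 (\<lambda>u. inverse (det (g u))) D"
proof (rule Ck_on_inverse[OF open_D])
  show "Ck_on 1 (\<lambda>u. det (g u)) D"
    unfolding det_2 by (intro Ck_on_diff Ck_on_mult open_D C1)
qed (rule det_pos)

lemma C1_matrix_inv: "Ck_on 1 (\<lambda>u. matrix_inv (g u) $ i $ j) D"
proof -
  have *: "Ck_on 1 (\<lambda>u. g u $ k $ l * inverse (det (g u))) D"
    "Ck_on 1 (\<lambda>u. - g u $ k $ l * inverse (det (g u))) D" for k l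
    by (intro Ck_on_mult Ck_on_minus open_D C1_inverse_det C1)+
  have nz: "det (g u) \<noteq> 0" if "u \<in> D" for u
    using det_pos[OF that] by simp
  have "Ck_on 1 (\<lambda>u. matrix_inv (g u) $ 1 $ 1) D" "Ck_on 1 (\<lambda>u. matrix_inv (g u) $ 2 $ 2) D"
    by (rule Ck_on_cong[OF open_D _ *(1)]; simp only: matrix_inv_2[OF nz])+
  moreover have "Ck_on 1 (\<lambda>u. matrix_inv (g u) $ 1 $ 2) D" "Ck_on 1 (\<lambda>u. matrix_inv (g u) $ 2 $ 1) D"
    by (rule Ck_on_cong[OF open_D _ *(2)]; simp only: matrix_inv_2[OF nz])+
  ultimately show ?thesis
    using exhaust_2[of i] exhaust_2[of j] by metis
qed

lemma C1_christoffel: "Ck_on 1 (christoffel g k i j) D"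
  unfolding christoffel_def[abs_def] sum_2
  by (intro Ck_on_mult Ck_on_add Ck_on_diff Ck_on_const open_D C1_partial C1_matrix_inv)

lemma partial_symmetric: "u \<in> D \<Longrightarrow> partial k (\<lambda>v. g v $ i $ j) u = partial k (\<lambda>v. g v $ j $ i) u"
  by (rule partial_cong[OF open_D]) (auto simp: symmetric')

lemma christoffel_commute: "u \<in> D \<Longrightarrow> christoffel g k i j u = christoffel g k j i u"
  by (simp add: christoffel_def partial_symmetric[of u _ i j] algebra_simps)

lemma metric_matrix_inv:
  assumes "u \<in> D"
  shows "(\<Sum>l\<in>UNIV. g u $ i $ l * matrix_inv (g u) $ l $ k) = (if i = k then 1 else 0)"
    and "(\<Sum>l\<in>UNIV. matrix_inv (g u) $ i $ l * g u $ l $ k) = (if i = k then 1 else 0)"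
proof -
  have "det (g u) \<noteq> 0"
    using det_pos[OF assms] by simp
  from arg_cong[OF invertible_matrix_inv(1)[OF this], of "\<lambda>A. A $ i $ k"]
    arg_cong[OF invertible_matrix_inv(2)[OF this], of "\<lambda>A. A $ i $ k"]
  show "(\<Sum>l\<in>UNIV. g u $ i $ l * matrix_inv (g u) $ l $ k) = (if i = k then 1 else 0)"
    "(\<Sum>l\<in>UNIV. matrix_inv (g u) $ i $ l * g u $ l $ k) = (if i = k then 1 else 0)"
    by (simp_all add: matrix_matrix_mult_def mat_def)
qed

text \<open>Covariant constancy of the metric. Lowering the upper index of a Christoffel symbol
  cancels the inverse metric; in the sum of the two lowered symbols everything but twice half the
  wanted derivative cancels in pairs.\<close>

lemma metric_compatible:
  assumes "u \<in> D"
  shows "partial m (\<lambda>v. g v $ i $ j) u =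
    (\<Sum>l\<in>UNIV. g u $ l $ j * christoffel g l m i u + g u $ i $ l * christoffel g l m j u)"
proof -
  have lower: "(\<Sum>l\<in>UNIV. g u $ i $ l * christoffel g l m j u) = 1/2 *
     (partial m (\<lambda>v. g v $ j $ i) u + partial j (\<lambda>v. g v $ m $ i) u - partial i (\<lambda>v. g v $ m $ j) u)" for i m j
  proof -
    let ?c = "\<lambda>n. partial m (\<lambda>v. g v $ j $ n) u + partial j (\<lambda>v. g v $ m $ n) u - partial n (\<lambda>v. g v $ m $ j) u"
    have "(\<Sum>l\<in>UNIV. g u $ i $ l * christoffel g l m j u)
      = 1/2 * (\<Sum>n\<in>UNIV. (\<Sum>l\<in>UNIV. g u $ i $ l * matrix_inv (g u) $ l $ n) * ?c n)"
      unfolding christoffel_def sum_2 by (simp add: algebra_simps)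
    also have "\<dots> = 1/2 * ?c i"
      using exhaust_2[of i] by (auto simp: metric_matrix_inv[OF assms] sum_2)
    finally show ?thesis .
  qed
  have "(\<Sum>l\<in>UNIV. g u $ l $ j * christoffel g l m i u + g u $ i $ l * christoffel g l m j u)
    = (\<Sum>l\<in>UNIV. g u $ j $ l * christoffel g l m i u) + (\<Sum>l\<in>UNIV. g u $ i $ l * christoffel g l m j u)"
    by (simp add: sum.distrib symmetric'[OF assms, of _ j])
  then show ?thesis
    unfolding lower partial_symmetric[OF assms, of _ j i] partial_symmetric[OF assms, of _ m i]
      partial_symmetric[OF assms, of _ j m]
    by (simp add: field_simps)
qed

text \<open>The contravariant components. With these as primitive quantities,
  \<open>partial_eq_gradient\<close> recovers the covariant ones by the metric alone, and
  derivatives of the inverse metric never have to be expanded.\<close>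

definition gradient :: "(real^2 \<Rightarrow> real) \<Rightarrow> 2 \<Rightarrow> real^2 \<Rightarrow> real" where
  "gradient f k u = (\<Sum>l\<in>UNIV. matrix_inv (g u) $ k $ l * partial l f u)"

lemma partial_eq_gradient:
  assumes "u \<in> D"
  shows "partial i f u = (\<Sum>l\<in>UNIV. g u $ i $ l * gradient f l u)"
proof -
  have "(\<Sum>l\<in>UNIV. g u $ i $ l * gradient f l u)
      = (\<Sum>n\<in>UNIV. (\<Sum>l\<in>UNIV. g u $ i $ l * matrix_inv (g u) $ l $ n) * partial n f u)"
    unfolding gradient_def sum_2 by (simp add: algebra_simps)
  then show ?thesis
    using exhaust_2[of i] by (auto simp: metric_matrix_inv[OF assms] sum_2)
qed

lemma C1_gradient:
  assumes "Ck_on 2 f D"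
  shows "Ck_on 1 (gradient f k) D"
proof -
  have "Ck_on 1 (partial l f) D" for l
    using assms by (simp add: numeral_2_eq_2)
  then show ?thesis
    unfolding gradient_def[abs_def] sum_2 by (intro Ck_on_add Ck_on_mult open_D C1_matrix_inv)
qed

text \<open>The factor exp \<mu> from the derivatives cancels against its reciprocal from the
  inverse metric; the derivatives of the factor itself leave three terms, two of which contract the
  metric with its inverse to Kronecker deltas.\<close>

lemma christoffel_conformal:
  assumes "u \<in> D" "\<mu> differentiable (at u)"
  shows "christoffel (\<lambda>v. exp (\<mu> v) *\<^sub>R g v) k i j u = christoffel g k i j u
    + 1/2 * ((if k = j then partial i \<mu> u else 0) + (if k = i then partial j \<mu> u else 0)
             - g u $ i $ j * gradient \<mu> k u)"
proof -
  have "(\<lambda>v. exp (\<mu> v)) differentiable (at u)"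
    using assms(2) by (auto simp: differentiable_def intro!: derivative_intros)
  then have p: "partial m (\<lambda>v. (exp (\<mu> v) *\<^sub>R g v) $ a $ b) u
    = exp (\<mu> u) * (partial m (\<lambda>v. g v $ a $ b) u + g u $ a $ b * partial m \<mu> u)" for m a b
    by (simp add: partial_mult differentiable_entry assms partial_DERIV[OF assms(2) DERIV_exp] algebra_simps)
  have inv: "matrix_inv (exp (\<mu> u) *\<^sub>R g u) = inverse (exp (\<mu> u)) *\<^sub>R matrix_inv (g u)"
    using det_pos[OF assms(1)] by (intro matrix_inv_scaleR_2) auto
  have e: "inverse (exp (\<mu> u)) * a * (exp (\<mu> u) * b) = a * b" for a b
    by simp
  have \<delta>: "(\<Sum>l\<in>UNIV. matrix_inv (g u) $ k $ l * g u $ m $ l) = (if k = m then 1 else 0)" for m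
    using metric_matrix_inv(2)[OF assms(1), of k m] by (simp add: symmetric'[OF assms(1), of m])
  have "christoffel (\<lambda>v. exp (\<mu> v) *\<^sub>R g v) k i j u = 1/2 * (\<Sum>l\<in>UNIV. (inverse (exp (\<mu> u)) * matrix_inv (g u) $ k $ l) *
     (exp (\<mu> u) * (partial i (\<lambda>v. g v $ j $ l) u + g u $ j $ l * partial i \<mu> u
      + (partial j (\<lambda>v. g v $ i $ l) u + g u $ i $ l * partial j \<mu> u)
      - (partial l (\<lambda>v. g v $ i $ j) u + g u $ i $ j * partial l \<mu> u))))"
    unfolding christoffel_def p inv by (simp add: algebra_simps)
  also have "\<dots> = christoffel g k i j u
    + 1/2 * ((\<Sum>l\<in>UNIV. matrix_inv (g u) $ k $ l * g u $ j $ l) * partial i \<mu> u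
       + (\<Sum>l\<in>UNIV. matrix_inv (g u) $ k $ l * g u $ i $ l) * partial j \<mu> u
             - g u $ i $ j * gradient \<mu> k u)"
    unfolding e unfolding gradient_def christoffel_def sum_2 by (simp add: algebra_simps)
  finally show ?thesis
    by (simp add: \<delta>)
qed

lemma scalar_curvature_conformal:
  assumes "u \<in> D" "Ck_on 2 \<mu> D"
  shows "scalar_curvature (\<lambda>v. exp (\<mu> v) *\<^sub>R g v) u = exp (- \<mu> u) * (scalar_curvature g u - 1/2 * laplacian g \<mu> u)"
proof -
  let ?\<Gamma> = "\<lambda>k i j. christoffel g k i j u" and ?W = "\<lambda>k. gradient \<mu> k u"
  have \<mu>: "\<mu> differentiable (at v)" if "v \<in> D" for v
    using Ck_on_imp_differentiable[OF assms(2)] that by simp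
  define T where "T k i j v = 1/2 * ((if k = j then partial i \<mu> v else 0) + (if k = i then partial j \<mu> v else 0)
             - g v $ i $ j * gradient \<mu> k v)" for k i j v
  have C: "christoffel (\<lambda>v. exp (\<mu> v) *\<^sub>R g v) k i j v = christoffel g k i j v + T k i j v" if "v \<in> D" for k i j v
    using christoffel_conformal[OF that \<mu>[OF that]] by (simp add: T_def)
  have dW: "gradient \<mu> k differentiable (at u)" for k
    using Ck_on_imp_differentiable[OF C1_gradient[OF assms(2)] _ assms(1)] by simp
  have d\<mu>: "partial i \<mu> differentiable (at u)" for i
    using assms by (simp add: numeral_2_eq_2)
  have dgW: "(\<lambda>v. g v $ i $ j * gradient \<mu> k v) differentiable (at u)" for i j k
    by (intro differentiable_mult differentiable_entry dW assms)
  have dif: "(\<lambda>v. if b then partial i \<mu> v else 0) differentiable (at u)"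
    "partial m (\<lambda>v. if b then partial i \<mu> v else 0) u = (if b then partial m (partial i \<mu>) u else 0)" for b i m
    by (cases b; simp add: d\<mu> partial_const)+
  have dT: "T k i j differentiable (at u)" for k i j
    unfolding T_def[abs_def] by (intro differentiable_mult differentiable_diff differentiable_add dif dgW) simp
  have pT: "partial m (T k i j) u = 1/2 * ((if k = j then partial m (partial i \<mu>) u else 0)
      + (if k = i then partial m (partial j \<mu>) u else 0)
      - (g u $ i $ j * partial m (gradient \<mu> k) u + partial m (\<lambda>v. g v $ i $ j) u * ?W k))" for m k i j
  proof -
    let ?A = "\<lambda>v. if k = j then partial i \<mu> v else 0" and ?B = "\<lambda>v. if k = i then partial j \<mu> v else 0"
    let ?C = "\<lambda>v. g v $ i $ j * gradient \<mu> k v"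
    have "partial m (T k i j) u = 1/2 * partial m (\<lambda>v. ?A v + ?B v - ?C v) u"
      unfolding T_def[abs_def] by (intro partial_cmult differentiable_diff differentiable_add dif(1) dgW)
    also have "partial m (\<lambda>v. ?A v + ?B v - ?C v) u = partial m (\<lambda>v. ?A v + ?B v) u - partial m ?C u"
      by (intro partial_diff differentiable_add dif(1) dgW)
    also have "partial m (\<lambda>v. ?A v + ?B v) u = partial m ?A u + partial m ?B u"
      by (intro partial_add dif(1))
    finally show ?thesis
      unfolding dif(2) partial_mult[OF differentiable_entry[OF assms(1)] dW] .
  qed
  \<comment> \<open>The Hessian comes from differentiating the relation between the differential of
    \<mu> and its gradient, so that only derivatives of the metric and of the gradient
    occur.\<close>
  have p\<mu>: "partial m (partial i \<mu>) u = (\<Sum>l\<in>UNIV. g u $ i $ l * partial m (gradient \<mu> l) u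
      + partial m (\<lambda>v. g v $ i $ l) u * ?W l)" for m i
  proof -
    have "partial m (partial i \<mu>) u = partial m (\<lambda>v. g v $ i $ 1 * gradient \<mu> 1 v + g v $ i $ 2 * gradient \<mu> 2 v) u"
      by (rule partial_cong[OF open_D assms(1)]) (simp add: partial_eq_gradient sum_2)
    then show ?thesis
      by (simp add: partial_add dgW partial_mult differentiable_entry assms(1) dW sum_2)
  qed
  have pC: "partial m (christoffel (\<lambda>v. exp (\<mu> v) *\<^sub>R g v) k i j) u
      = partial m (christoffel g k i j) u + partial m (T k i j) u" for m k i j
    using partial_cong[OF open_D assms(1) C]
      partial_add[OF Ck_on_imp_differentiable[OF C1_christoffel _ assms(1)] dT]
    by simp
  \<comment> \<open>Change of the Ricci tensor plus covariant Hessian of \<mu>. In dimension two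
    this is the trace-free part of that Hessian; only the vanishing of its trace is
    established.\<close>
  define E where "E i j = ricci (\<lambda>v. exp (\<mu> v) *\<^sub>R g v) i j u - ricci g i j u
    + (partial j (partial i \<mu>) u - (\<Sum>k\<in>UNIV. ?\<Gamma> k i j * partial k \<mu> u))" for i j
  have E: "E i j = (\<Sum>k\<in>UNIV. partial k (T k i j) u - partial j (T k i k) u)
    + (\<Sum>k\<in>UNIV. \<Sum>l\<in>UNIV. ?\<Gamma> k k l * T l i j u + T k k l u * (?\<Gamma> l i j + T l i j u)
         - ?\<Gamma> k j l * T l i k u - T k j l u * (?\<Gamma> l i k + T l i k u))
    + (partial j (partial i \<mu>) u - (\<Sum>k\<in>UNIV. ?\<Gamma> k i j * partial k \<mu> u))" for i j
    unfolding E_def ricci_def pC C[OF assms(1)]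
    by (simp add: sum.distrib sum_subtractf algebra_simps)
  have "g u $ 2 $ 2 * E 1 1 - g u $ 1 $ 2 * (E 1 2 + E 2 1) + g u $ 1 $ 1 * E 2 2 = 0"
    by (rule conformal_trace[OF symmetric[OF assms(1)] christoffel_commute[OF assms(1)]
          metric_compatible[OF assms(1)] partial_eq_gradient[OF assms(1)] p\<mu> T_def pT E])
  \<comment> \<open>The trace uses the inverse metric, \<open>conformal_trace\<close> the adjugate;
    they differ by the determinant, which is why the latter could be stated as a polynomial
    identity.\<close>
  moreover have "(\<Sum>i\<in>UNIV. \<Sum>j\<in>UNIV. matrix_inv (g u) $ i $ j * E i j)
    = inverse (det (g u)) * (g u $ 2 $ 2 * E 1 1 - g u $ 1 $ 2 * (E 1 2 + E 2 1) + g u $ 1 $ 1 * E 2 2)"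
    using det_pos[OF assms(1)] symmetric[OF assms(1)]
    by (simp add: sum_2 matrix_inv_2 algebra_simps)
  ultimately have "(\<Sum>i\<in>UNIV. \<Sum>j\<in>UNIV. matrix_inv (g u) $ i $ j * E i j) = 0"
    by simp
  then have *: "(\<Sum>i\<in>UNIV. \<Sum>j\<in>UNIV. matrix_inv (g u) $ i $ j * ricci (\<lambda>v. exp (\<mu> v) *\<^sub>R g v) i j u)
    = (\<Sum>i\<in>UNIV. \<Sum>j\<in>UNIV. matrix_inv (g u) $ i $ j * ricci g i j u) - laplacian g \<mu> u"
    unfolding E_def laplacian_def by (simp add: ring_distribs sum.distrib sum_subtractf)
  have inv: "matrix_inv (exp (\<mu> u) *\<^sub>R g u) = exp (- \<mu> u) *\<^sub>R matrix_inv (g u)"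
    using det_pos[OF assms(1)] by (subst matrix_inv_scaleR_2) (auto simp: exp_minus)
  have "scalar_curvature (\<lambda>v. exp (\<mu> v) *\<^sub>R g v) u
    = exp (- \<mu> u) * (1/2 * (\<Sum>i\<in>UNIV. \<Sum>j\<in>UNIV. matrix_inv (g u) $ i $ j * ricci (\<lambda>v. exp (\<mu> v) *\<^sub>R g v) i j u))"
    unfolding scalar_curvature_def inv sum_2 by (simp add: algebra_simps)
  then show ?thesis
    unfolding * scalar_curvature_def by (simp add: right_diff_distrib)
qed

end

section \<open>The strong maximum principle\<close>

definition elliptic_operator ::
    "(real^2 \<Rightarrow> 2 \<Rightarrow> 2 \<Rightarrow> real) \<Rightarrow> (real^2 \<Rightarrow> 2 \<Rightarrow> real) \<Rightarrow> (real^2 \<Rightarrow> real) \<Rightarrow> real^2 \<Rightarrow> real" where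
  "elliptic_operator a b f u = (\<Sum>i\<in>UNIV. \<Sum>j\<in>UNIV. a u i j * partial j (partial i f) u) + (\<Sum>i\<in>UNIV. b u i * partial i f u)"

lemma elliptic_operator_nonpos_at_max:
  assumes "open D" "Ck_on 2 f D" "p \<in> D" "\<And>v. v \<in> D \<Longrightarrow> f v \<le> f p"
    and "a p 1 1 > 0" "a p 1 1 * a p 2 2 - a p 1 2 * a p 1 2 > 0" "a p 2 1 = a p 1 2"
  shows "elliptic_operator a b f p \<le> 0"
  using elliptic_operator_at_max[OF assms(1-6)]
  by (simp add: elliptic_operator_def sum_2 assms(7) algebra_simps)

section \<open>Gaussian comparison functions\<close>

lemma partial_component: "partial i (\<lambda>v::real^2. v $ j) u = (if i = j then 1 else 0)"
proof -
  have "((\<lambda>v::real^2. v $ j) has_derivative (\<lambda>h. h $ j)) (at u)"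
    by (rule bounded_linear_imp_has_derivative[OF bounded_linear_vec_nth])
  from partial_eqI[OF this] show ?thesis
    by (simp add: axis_def)
qed

lemma Ck_on_component:
  assumes "open D"
  shows "Ck_on k (\<lambda>v::real^2. v $ j) D"
proof (cases k)
  case (Suc l)
  have "partial i (\<lambda>v::real^2. v $ j) = (\<lambda>u. if i = j then 1 else 0)" for i
    by (simp add: partial_component fun_eq_iff)
  then have "Ck_on l (partial i (\<lambda>v::real^2. v $ j)) D" for i
    by (simp add: Ck_on_const)
  moreover have "(\<lambda>v::real^2. v $ j) differentiable (at u)" for u
    using bounded_linear_imp_differentiable[OF bounded_linear_vec_nth] .
  ultimately show ?thesis
    using Suc by simp
qed (auto intro!: continuous_intros)

lemma Ck_on_exp:
  fixes f :: "real^2 \<Rightarrow> real"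
  assumes "open D" "Ck_on k f D"
  shows "Ck_on k (\<lambda>u. exp (f u)) D"
  using assms(2)
proof (induction k)
  case 0
  then show ?case
    by (simp add: continuous_on_exp)
next
  case (Suc k)
  have "Ck_on k (partial i (\<lambda>u. exp (f u))) D" for i
  proof (rule Ck_on_cong[OF assms(1)])
    show "Ck_on k (\<lambda>u. exp (f u) * partial i f u) D"
      using Suc.prems Ck_on_mono[OF Suc.prems, of k] by (intro Ck_on_mult assms(1) Suc.IH) simp_all
    show "exp (f u) * partial i f u = partial i (\<lambda>u. exp (f u)) u" if "u \<in> D" for u
      using partial_DERIV[where f = f and u = u, OF _ DERIV_exp, of i] Suc.prems that by simp
  qed
  moreover have "(\<lambda>u. exp (f u)) differentiable (at u)" if "u \<in> D" for u
    using Ck_on_imp_differentiable[OF Suc.prems _ that]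
    unfolding differentiable_def by (auto intro: has_derivative_exp)
  ultimately show ?case
    by simp
qed

lemma gaussian_partials:
  fixes x :: "real^2" and \<alpha> :: real
  defines "v \<equiv> \<lambda>p. exp (- \<alpha> * ((p $ 1 - x $ 1)\<^sup>2 + (p $ 2 - x $ 2)\<^sup>2))"
  shows "Ck_on k v UNIV" "partial i v p = - 2 * \<alpha> * (p $ i - x $ i) * v p"
    "partial j (partial i v) p = (4 * \<alpha>\<^sup>2 * (p $ i - x $ i) * (p $ j - x $ j) - (if i = j then 2 * \<alpha> else 0)) * v p"
proof -
  let ?s = "\<lambda>p::real^2. - \<alpha> * ((p $ 1 - x $ 1)\<^sup>2 + (p $ 2 - x $ 2)\<^sup>2)"
  have lin: "Ck_on k (\<lambda>p::real^2. p $ l - x $ l) UNIV" for k l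
    by (intro Ck_on_diff Ck_on_component Ck_on_const) auto
  have s: "Ck_on k ?s UNIV" for k
    unfolding power2_eq_square by (intro Ck_on_mult Ck_on_add Ck_on_const lin) auto
  show C: "Ck_on k v UNIV" for k
    unfolding v_def by (intro Ck_on_exp s) auto
  have d: "(\<lambda>p. p $ l - x $ l) differentiable (at p)" for l p
    using Ck_on_imp_differentiable[OF lin] by auto
  have pd: "partial i (\<lambda>p. p $ l - x $ l) p = (if i = l then 1 else 0)" for i l p
    by (subst partial_diff)
      (auto simp: partial_component intro: bounded_linear_imp_differentiable[OF bounded_linear_vec_nth])
  have sq: "(\<lambda>p. (p $ l - x $ l)\<^sup>2) differentiable (at p)"
    "partial i (\<lambda>p. (p $ l - x $ l)\<^sup>2) p = 2 * (p $ l - x $ l) * (if i = l then 1 else 0)" for i l p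
    unfolding power2_eq_square by (intro differentiable_mult d) (simp add: partial_mult d pd)
  have "partial i ?s p = - \<alpha> * (2 * (p $ i - x $ i))" for i p
    using exhaust_2[of i] by (subst partial_cmult) (auto intro!: differentiable_add sq simp: partial_add sq)
  moreover have "?s differentiable (at p)" for p
    using Ck_on_imp_differentiable[OF s] by auto
  ultimately show 1: "partial i v p = - 2 * \<alpha> * (p $ i - x $ i) * v p" for i p
    unfolding v_def using partial_DERIV[where f = ?s and u = p, OF _ DERIV_exp, of i] by simp
  have vd: "v differentiable (at p)" for p
    using Ck_on_imp_differentiable[OF C] by auto
  have "partial i v = (\<lambda>p. (- 2 * \<alpha>) * ((p $ i - x $ i) * v p))"
    using 1 by (simp add: fun_eq_iff)
  then have "partial j (partial i v) p = (- 2 * \<alpha>) * partial j (\<lambda>p. (p $ i - x $ i) * v p) p"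
    by (simp only: partial_cmult[OF differentiable_mult[OF d vd]])
  also have "partial j (\<lambda>p. (p $ i - x $ i) * v p) p = (p $ i - x $ i) * partial j v p + (if j = i then 1 else 0) * v p"
    by (simp only: partial_mult[OF d vd] pd)
  also have "- 2 * \<alpha> * ((p $ i - x $ i) * partial j v p + (if j = i then 1 else 0) * v p)
    = (4 * \<alpha>\<^sup>2 * (p $ i - x $ i) * (p $ j - x $ j) - (if i = j then 2 * \<alpha> else 0)) * v p"
    unfolding 1 by (simp add: power2_eq_square algebra_simps)
  finally show "partial j (partial i v) p = (4 * \<alpha>\<^sup>2 * (p $ i - x $ i) * (p $ j - x $ j) - (if i = j then 2 * \<alpha> else 0)) * v p" .
qed

text \<open>Arranged so that, for positive \<alpha>, the sign is that of the last factor: 2 *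
  \<alpha> times a quadratic form, which is positive away from x for elliptic coefficients, minus a
  term free of \<alpha>. A large \<alpha> makes it positive at any given point other than x.\<close>

lemma elliptic_operator_gaussian:
  fixes x :: "real^2" and \<alpha> :: real
  defines "v \<equiv> \<lambda>p. exp (- \<alpha> * ((p $ 1 - x $ 1)\<^sup>2 + (p $ 2 - x $ 2)\<^sup>2))"
  shows "elliptic_operator a b v p = 2 * \<alpha> * v p *
    (2 * \<alpha> * (\<Sum>i\<in>UNIV. \<Sum>j\<in>UNIV. a p i j * (p $ i - x $ i) * (p $ j - x $ j))
     - (a p 1 1 + a p 2 2 + (\<Sum>i\<in>UNIV. b p i * (p $ i - x $ i))))"
  unfolding elliptic_operator_def sum_2 v_def gaussian_partials
  by (simp add: power2_eq_square algebra_simps)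

lemma elliptic_operator_linear:
  assumes "open D" "Ck_on 2 f D" "Ck_on 2 g D" "p \<in> D"
  shows "elliptic_operator a b (\<lambda>u. f u + k * g u) p = elliptic_operator a b f p + k * elliptic_operator a b g p"
proof -
  have C: "Ck_on (Suc (Suc 0)) f D" "Ck_on (Suc (Suc 0)) g D"
    using assms by (simp_all only: numeral_2_eq_2)
  then have d: "f differentiable (at u)" "g differentiable (at u)"
     "partial i f differentiable (at u)" "partial i g differentiable (at u)" if "u \<in> D" for i u
    using that by (meson Ck_on.simps(2))+
  have 1: "partial i (\<lambda>u. f u + k * g u) u = partial i f u + k * partial i g u" if "u \<in> D" for i u
    using d[OF that] by (simp add: partial_add partial_cmult differentiable_mult)
  have "partial j (partial i (\<lambda>u. f u + k * g u)) p = partial j (\<lambda>u. partial i f u + k * partial i g u) p" for i j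
    by (rule partial_cong[OF assms(1,4) 1])
  also have "partial j (\<lambda>u. partial i f u + k * partial i g u) p = partial j (partial i f) p + k * partial j (partial i g) p" for i j
    using d[OF assms(4)] by (simp add: partial_add partial_cmult differentiable_mult)
  finally show ?thesis
    unfolding elliptic_operator_def sum_2 1[OF assms(4)] by (simp only:) (simp add: algebra_simps)
qed

text \<open>Multiplication by a yields a sum of two squares with positive weights. Used both for the
  Gaussian estimate and for the sign of the second fundamental form under a change of chart.\<close>

lemma elliptic_quadratic_pos:
  fixes a b c x y :: real
  assumes "a > 0" "a * c - b * b > 0" "x \<noteq> 0 \<or> y \<noteq> 0"
  shows "a * x * x + b * x * y + (b * y * x + c * y * y) > 0"
proof -
  have "a * (a * x * x + b * x * y + (b * y * x + c * y * y)) = (a * x + b * y)\<^sup>2 + (a * c - b * b) * y\<^sup>2"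
    by (simp add: power2_eq_square algebra_simps)
  also have "\<dots> > 0"
  proof (cases "y = 0")
    case True
    then show ?thesis
      using assms by simp
  next
    case False
    then show ?thesis
      using assms by (intro add_nonneg_pos) auto
  qed
  finally show ?thesis
    using assms(1) by (simp add: zero_less_mult_iff)
qed

text \<open>The ball with diameter from x to z lies in the ball about x through z and meets its
  sphere only in z. With w and d measured from the midpoint, the parallelogram law forces w = d as
  soon as the norm of w + d reaches 2 * norm d.\<close>

lemma strictly_convex_ball:
  fixes x z v :: "'a::real_inner"
  defines "c \<equiv> (1/2) *\<^sub>R (x + z)"
  assumes "dist v c \<le> dist z c" "v \<noteq> z"
  shows "dist x v < dist x z"
proof (rule ccontr)
  assume "\<not> dist x v < dist x z"
  define w d where "w = v - c" and "d = z - c"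
  have "c + c = x + z"
    by (simp add: c_def flip: scaleR_2)
  then have x: "x = c + c - z"
    by simp
  have xv: "v - x = w + d" and vz: "v - z = w - d" and xz: "z - x = 2 *\<^sub>R d"
    unfolding x w_def d_def by (simp_all add: scaleR_2)
  have "norm w \<le> norm d"
    using assms(2) by (simp add: w_def d_def dist_norm)
  moreover have "2 * norm d \<le> norm (w + d)"
    using \<open>\<not> dist x v < dist x z\<close> xv xz by (simp add: dist_norm norm_minus_commute[of x])
  moreover have "(norm (w - d))\<^sup>2 = 2 * (norm w)\<^sup>2 + 2 * (norm d)\<^sup>2 - (norm (w + d))\<^sup>2"
    by (simp add: power2_norm_eq_inner inner_diff_left inner_diff_right inner_add_left inner_add_right inner_commute)
  moreover from calculation have "(norm w)\<^sup>2 \<le> (norm d)\<^sup>2" "(2 * norm d)\<^sup>2 \<le> (norm (w + d))\<^sup>2"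
    by (simp_all only: power_mono norm_ge_zero mult_nonneg_nonneg zero_le_numeral)
  moreover have "(2 * norm d)\<^sup>2 = 4 * (norm d)\<^sup>2"
    by (simp add: power_mult_distrib)
  ultimately have "(norm (w - d))\<^sup>2 \<le> 0"
    by linarith
  then show False
    using vz assms(3) by simp
qed

text \<open>Hopf's argument: at a maximum $z$ touched by a ball around $c$ on which $f$ is smaller, adding a small
  multiple of a Gaussian centred at $c$ produces an interior maximum where the operator is positive.\<close>

lemma hopf_contradiction:
  fixes f :: "real^2 \<Rightarrow> real"
  assumes D: "open D" "Ck_on 2 f D"
    and cont: "\<And>i j. continuous_on D (\<lambda>u. a u i j)" "\<And>i. continuous_on D (\<lambda>u. b u i)"
    and pos: "\<And>u. u \<in> D \<Longrightarrow> a u 1 1 > 0" "\<And>u. u \<in> D \<Longrightarrow> a u 1 1 * a u 2 2 - a u 1 2 * a u 1 2 > 0"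
      "\<And>u. u \<in> D \<Longrightarrow> a u 2 1 = a u 1 2"
    and sub: "\<And>u. u \<in> D \<Longrightarrow> elliptic_operator a b f u \<ge> 0"
    and max: "z \<in> D" "\<And>v. v \<in> D \<Longrightarrow> f v \<le> f z"
    and ball: "c \<noteq> z" "\<And>v. v \<in> D \<Longrightarrow> dist v c \<le> dist z c \<Longrightarrow> v \<noteq> z \<Longrightarrow> f v < f z"
  shows False
proof -
  define Q where "Q p = (\<Sum>i\<in>UNIV. \<Sum>j\<in>UNIV. a p i j * (p $ i - c $ i) * (p $ j - c $ j))" for p
  define B where "B p = a p 1 1 + a p 2 2 + (\<Sum>i\<in>UNIV. b p i * (p $ i - c $ i))" for p
  \<comment> \<open>Chosen to give h z = 2 * (\<bar>B z\<bar> + 1) - B z > 0, where h is the factor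
    that decides the sign of the operator on the Gaussian.\<close>
  define \<alpha> where "\<alpha> = (\<bar>B z\<bar> + 1) / Q z"
  define h where "h p = 2 * \<alpha> * Q p - B p" for p
  define v where "v p = exp (- \<alpha> * ((p $ 1 - c $ 1)\<^sup>2 + (p $ 2 - c $ 2)\<^sup>2))" for p :: "real^2"
  have dist_c: "(p $ 1 - c $ 1)\<^sup>2 + (p $ 2 - c $ 2)\<^sup>2 = (dist p c)\<^sup>2" for p
    by (simp add: dist_norm norm_vec_def L2_set_def sum_2 sum_nonneg)
  have "z $ 1 - c $ 1 \<noteq> 0 \<or> z $ 2 - c $ 2 \<noteq> 0"
    using ball(1) by (auto simp: vec_eq_iff forall_2)
  from elliptic_quadratic_pos[OF pos(1,2)[OF max(1)] this] have "Q z > 0"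
    by (simp add: Q_def sum_2 pos(3)[OF max(1)] algebra_simps)
  then have "\<alpha> > 0" "\<alpha> * Q z = \<bar>B z\<bar> + 1"
    by (simp_all add: \<alpha>_def)
  then have "h z > 0"
    by (simp add: h_def mult.assoc)
  have "continuous_on D h"
    unfolding h_def Q_def B_def sum_2 by (intro continuous_intros cont)
  then have "open (D \<inter> h -` {0<..})"
    using D(1) by (intro continuous_open_preimage) auto
  moreover have "z \<in> D \<inter> h -` {0<..}"
    using \<open>h z > 0\<close> max(1) by simp
  ultimately obtain \<epsilon> where \<epsilon>: "\<epsilon> > 0" "cball z \<epsilon> \<subseteq> D \<inter> h -` {0<..}"
    using open_contains_cball by blast
  have f_cont: "continuous_on S f" if "S \<subseteq> D" for S
    using Ck_on_imp_continuous_on[OF D(2)] that continuous_on_subset by blast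
  have Cv: "Ck_on 2 v S" for S
    using gaussian_partials(1)[of 2 \<alpha> c] unfolding v_def by (rule Ck_on_subset) simp
  \<comment> \<open>The small sphere splits in two. On S the function f stays below its maximum by a
    uniform gap, by compactness; off S the distance to c is larger than at z, so the Gaussian is
    smaller than at z.\<close>
  define S where "S = sphere z \<epsilon> \<inter> cball c (dist z c)"
  have S_D: "S \<subseteq> D"
    using \<epsilon>(2) by (auto simp: S_def)
  have "\<exists>\<delta>>0. \<forall>p\<in>S. f p \<le> f z - \<delta>"
  proof (cases "S = {}")
    case True
    then show ?thesis
      by (intro exI[of _ 1]) simp
  next
    case False
    moreover have "compact S"
      by (simp add: S_def compact_Int_closed)
    ultimately obtain q where q: "q \<in> S" "\<forall>p\<in>S. f p \<le> f q"
      using continuous_attains_sup[of S f] f_cont[OF S_D] by blast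
    then have "q \<in> D" "dist z q = \<epsilon>" "dist q c \<le> dist z c"
      using S_D by (auto simp: S_def dist_commute)
    then have "f q < f z"
      using ball(2)[of q] \<epsilon>(1) by fastforce
    then show ?thesis
      using q(2) by (intro exI[of _ "f z - f q"]) simp
  qed
  then obtain \<delta> where \<delta>: "\<delta> > 0" "\<And>p. p \<in> S \<Longrightarrow> f p \<le> f z - \<delta>"
    by blast
  \<comment> \<open>The Gaussian is at most 1, so with half the gap as its factor it cannot lift f
    on S to the value at z.\<close>
  define k where "k = \<delta> / 2"
  define G where "G p = f p + k * v p" for p
  have v: "v p > 0" "v p \<le> 1" for p
    using \<open>\<alpha> > 0\<close> by (simp_all add: v_def)
  have sphere: "G p < G z" if "p \<in> sphere z \<epsilon>" for p
  proof (cases "p \<in> S")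
    case True
    have "k * v p \<le> k * 1"
      using v(2) \<delta>(1) by (intro mult_left_mono) (auto simp: k_def)
    moreover have "0 < k * v z"
      using v(1) \<delta>(1) by (simp add: k_def)
    ultimately show ?thesis
      using \<delta>(2)[OF True] \<delta>(1) unfolding G_def k_def by linarith
  next
    case False
    then have "dist z c < dist p c"
      using that by (simp add: S_def dist_commute)
    then have "(dist z c)\<^sup>2 < (dist p c)\<^sup>2"
      by (simp add: power_strict_mono)
    then have "v p < v z"
      using \<open>\<alpha> > 0\<close> unfolding v_def dist_c by simp
    then have "k * v p < k * v z"
      using \<delta>(1) by (simp add: k_def)
    moreover have "f p \<le> f z"
      using that \<epsilon>(2) by (intro max(2)) auto
    ultimately show ?thesis
      unfolding G_def by linarith
  qed
  have "continuous_on (cball z \<epsilon>) G"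
    unfolding G_def using \<epsilon>(2) by (intro continuous_intros f_cont Ck_on_imp_continuous_on[OF Cv]) auto
  then obtain p where p: "p \<in> cball z \<epsilon>" "\<forall>q\<in>cball z \<epsilon>. G q \<le> G p"
    using continuous_attains_sup[of "cball z \<epsilon>" G] \<epsilon>(1) by auto
  have "p \<notin> sphere z \<epsilon>"
  proof
    assume "p \<in> sphere z \<epsilon>"
    from sphere[OF this] have "G p < G z" .
    moreover have "G z \<le> G p"
      using p(2) \<epsilon>(1) by simp
    ultimately show False
      by simp
  qed
  then have p_ball: "p \<in> ball z \<epsilon>"
    using p(1) by simp
  have pD: "p \<in> D" and "h p > 0"
    using p(1) \<epsilon>(2) by auto
  have C_ball: "Ck_on 2 f (ball z \<epsilon>)"
    using \<epsilon>(2) by (intro Ck_on_subset[OF D(2)]) auto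
  have "Ck_on 2 G (ball z \<epsilon>)"
    unfolding G_def by (intro Ck_on_add Ck_on_mult Ck_on_const C_ball Cv) auto
  from elliptic_operator_nonpos_at_max[where a = a and b = b, OF open_ball this p_ball _ pos[OF pD]]
  have "elliptic_operator a b G p \<le> 0"
    using p(2) by simp
  moreover have "elliptic_operator a b G p = elliptic_operator a b f p + k * (2 * \<alpha> * v p * h p)"
    unfolding G_def elliptic_operator_linear[OF open_ball C_ball Cv p_ball]
    unfolding v_def elliptic_operator_gaussian h_def Q_def B_def ..
  moreover have "k * (2 * \<alpha> * v p * h p) > 0"
    using \<delta>(1) \<open>\<alpha> > 0\<close> v(1) \<open>h p > 0\<close> by (simp add: k_def)
  ultimately show False
    using sub[OF pD] by simp
qed

text \<open>If a point x near u had a smaller value, the point z of the maximum level nearest to x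
  would lie on the boundary of a ball in which f is strictly smaller, which is the situation
  excluded by \<open>hopf_contradiction\<close>. The local conclusion is the form suited to an
  open-closed argument on the surface.\<close>

lemma strong_maximum_principle:
  fixes f :: "real^2 \<Rightarrow> real"
  assumes D: "open D" "Ck_on 2 f D"
    and cont: "\<And>i j. continuous_on D (\<lambda>u. a u i j)" "\<And>i. continuous_on D (\<lambda>u. b u i)"
    and pos: "\<And>u. u \<in> D \<Longrightarrow> a u 1 1 > 0" "\<And>u. u \<in> D \<Longrightarrow> a u 1 1 * a u 2 2 - a u 1 2 * a u 1 2 > 0"
      "\<And>u. u \<in> D \<Longrightarrow> a u 2 1 = a u 1 2"
    and sub: "\<And>u. u \<in> D \<Longrightarrow> elliptic_operator a b f u \<ge> 0"
    and max: "u \<in> D" "\<And>v. v \<in> D \<Longrightarrow> f v \<le> f u"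
  obtains E where "open E" "u \<in> E" "E \<subseteq> D" "\<And>v. v \<in> E \<Longrightarrow> f v = f u"
proof -
  obtain R where R: "R > 0" "ball u R \<subseteq> D"
    using D(1) max(1) open_contains_ball by blast
  \<comment> \<open>Half the radius keeps the closed ball about x through u inside the ball of
    radius R about u, hence inside D.\<close>
  have const: "f x = f u" if x: "x \<in> ball u (R/2)" for x
  proof (rule ccontr)
    assume ne: "f x \<noteq> f u"
    define K where "K = {v \<in> cball x (dist x u). f v = f u}"
    have cball_D: "v \<in> D" if "dist x v \<le> dist x u" for v
      using x that R(2) dist_triangle[of u v x] by (auto simp: dist_commute)
    have "continuous_on (cball x (dist x u)) f"
      using Ck_on_imp_continuous_on[OF D(2)] cball_D by (auto intro: continuous_on_subset)
    then have "closed K"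
      unfolding K_def by (intro continuous_closed_preimage_constant) auto
    moreover have "u \<in> K"
      by (simp add: K_def)
    ultimately obtain z where z: "z \<in> K" "\<And>v. v \<in> K \<Longrightarrow> dist x z \<le> dist x v"
      using distance_attains_inf[of K x] by blast
    have zu: "dist x z \<le> dist x u" "f z = f u"
      using z(1) by (auto simp: K_def)
    have less: "f v < f z" if "dist x v < dist x z" for v
    proof -
      have "v \<notin> K"
        using z(2)[of v] that by auto
      then have "f v \<noteq> f u" "v \<in> D"
        using that zu by (auto simp: K_def intro: cball_D)
      then show ?thesis
        using max(2)[of v] zu by simp
    qed
    \<comment> \<open>The ball about x may touch the maximum level at several boundary points; the
      ball about the midpoint of x and z isolates z.\<close>
    let ?c = "(1/2) *\<^sub>R (x + z)"
    have "z - ?c = (1/2) *\<^sub>R (z - x)"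
      by (simp add: algebra_simps flip: scaleR_add_left)
    then have "?c \<noteq> z"
      using ne zu(2) by auto
    then show False
      using hopf_contradiction[OF D cont pos sub cball_D[OF zu(1)], of ?c] max(2) zu(2)
        less strictly_convex_ball by metis
  qed
  show ?thesis
  proof (rule that[OF open_ball _ _ const])
    show "u \<in> ball u (R/2)" "ball u (R/2) \<subseteq> D"
      using R by auto
  qed
qed

section \<open>Regularity of the normal field and of the support function\<close>

text \<open>Being orthogonal to both tangent vectors, n is plus or minus their normalized cross
  product N. The sign may depend on the chart, but continuity of n fixes it near each point, and
  there n is an explicit expression in the first derivatives of X.\<close>

lemma Ck_on_normal:
  fixes X n :: "real^2 \<Rightarrow> real^3"
  assumes D: "open D" "Ck_on (Suc k) X D" "continuous_on D n"
    and unit: "\<And>u. u \<in> D \<Longrightarrow> norm (n u) = 1"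
    and normal: "\<And>u i. u \<in> D \<Longrightarrow> n u \<bullet> partial i X u = 0"
    and regular: "\<And>u. u \<in> D \<Longrightarrow> cross3 (partial 1 X u) (partial 2 X u) \<noteq> 0"
  shows "Ck_on k n D"
proof (rule Ck_on_local)
  fix u assume u: "u \<in> D"
  define N where "N v = cross3 (partial 1 X v) (partial 2 X v)" for v
  have N: "Ck_on k N D"
    unfolding N_def
    by (rule bounded_bilinear.Ck_on[OF bilinear_conv_bounded_bilinear[THEN iffD1, OF bilinear_cross] D(1)])
      (use D(2) in simp_all)
  have *: "(n v \<bullet> N v)\<^sup>2 = N v \<bullet> N v" "n v = ((n v \<bullet> N v) / (N v \<bullet> N v)) *\<^sub>R N v" if "v \<in> D" for v
  proof -
    have "cross3 (n v) (N v) = 0"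
      unfolding N_def Lagrange using normal[OF that] by simp
    then show sq: "(n v \<bullet> N v)\<^sup>2 = N v \<bullet> N v"
      using norm_cross_dot[of "n v" "N v"] unit[OF that] by (simp add: power2_norm_eq_inner)
    define t where "t = (n v \<bullet> N v) / (N v \<bullet> N v)"
    have "(norm (n v - t *\<^sub>R N v))\<^sup>2 = (norm (n v))\<^sup>2 - 2 * t * (n v \<bullet> N v) + t * t * (N v \<bullet> N v)"
      unfolding power2_norm_eq_inner
      by (simp add: inner_diff_left inner_diff_right inner_commute algebra_simps)
    also have "\<dots> = 0"
    proof -
      have "N v \<bullet> N v \<noteq> 0"
        using regular[OF that] by (simp add: N_def)
      then have "t * (N v \<bullet> N v) = n v \<bullet> N v" "t * (n v \<bullet> N v) = 1"
        using sq by (simp_all add: t_def power2_eq_square)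
      then show ?thesis
        using unit[OF that] by (simp add: mult.assoc)
    qed
    finally show "n v = ((n v \<bullet> N v) / (N v \<bullet> N v)) *\<^sub>R N v"
      by (simp add: t_def)
  qed
  have N0: "N v \<bullet> N v > 0" if "v \<in> D" for v
    using regular[OF that] by (simp add: N_def)
  \<comment> \<open>The sign of n relative to N at u; on the open set E below it is still the sign,
    so n is \<sigma> * (N \<bullet> N) powr (-1/2) times N throughout E.\<close>
  define \<sigma> where "\<sigma> = sgn (n u \<bullet> N u)"
  have "n u \<bullet> N u \<noteq> 0"
    using *(1)[OF u] N0[OF u] by auto
  then have \<sigma>: "\<sigma> * (n u \<bullet> N u) > 0" "\<sigma> = 1 \<or> \<sigma> = -1"
    by (auto simp: \<sigma>_def sgn_if)
  define E where "E = D \<inter> (\<lambda>v. \<sigma> * (n v \<bullet> N v)) -` {0<..}"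
  have "open E"
    unfolding E_def using D(1,3) Ck_on_imp_continuous_on[OF N]
    by (intro continuous_open_preimage) (auto intro!: continuous_intros)
  moreover have "u \<in> E"
    using u \<sigma> by (simp add: E_def)
  moreover have "Ck_on k n E"
  proof (rule Ck_on_cong[OF \<open>open E\<close>])
    have NE: "Ck_on k N E"
      using N by (rule Ck_on_subset) (auto simp: E_def)
    show "Ck_on k (\<lambda>v. (\<sigma> * (N v \<bullet> N v) powr (-1/2)) *\<^sub>R N v) E"
      using N0 by (intro Ck_on_scaleR Ck_on_mult Ck_on_const Ck_on_powr Ck_on_inner NE \<open>open E\<close>)
        (auto simp: E_def)
    fix v assume "v \<in> E"
    then have v: "v \<in> D" "\<sigma> * (n v \<bullet> N v) > 0"
      by (auto simp: E_def)
    have "\<sigma> * (n v \<bullet> N v) = \<bar>n v \<bullet> N v\<bar>"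
      using v(2) \<sigma>(2) by auto
    also have "\<dots> = sqrt (N v \<bullet> N v)"
      by (metis *(1) v(1) real_sqrt_abs)
    finally have "\<sigma> * \<sigma> * (n v \<bullet> N v) = \<sigma> * sqrt (N v \<bullet> N v)"
      by simp
    moreover have "\<sigma> * \<sigma> = 1"
      using \<sigma>(2) by auto
    ultimately have s: "n v \<bullet> N v = \<sigma> * sqrt (N v \<bullet> N v)"
      by simp
    have "(N v \<bullet> N v) powr (-1/2) = sqrt (N v \<bullet> N v) / (N v \<bullet> N v)"
      using N0[OF v(1)] by (simp add: powr_minus powr_half_sqrt field_simps flip: power2_eq_square)
    then show "(\<sigma> * (N v \<bullet> N v) powr (-1/2)) *\<^sub>R N v = n v"
      using *(2)[OF v(1)] by (simp add: s)
  qed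
  ultimately show "\<exists>E. open E \<and> u \<in> E \<and> Ck_on k n E"
    by blast
qed

text \<open>Since the derivatives of $Y$ are tangential, the first derivatives of $n \cdot Y$ do not involve
  those of $Y$; so the support function is one class smoother than $Y$.\<close>

lemma Ck_on_support:
  fixes n Y :: "real^2 \<Rightarrow> real^3"
  assumes "open D" "Ck_on 2 n D" "Ck_on 1 Y D" "\<And>u i. u \<in> D \<Longrightarrow> n u \<bullet> partial i Y u = 0"
  shows "Ck_on 2 (\<lambda>u. n u \<bullet> Y u) D"
proof -
  have n: "Ck_on (Suc 1) n D"
    using assms(2) by (simp only: Suc_1)
  have d: "n differentiable (at u)" "Y differentiable (at u)" if "u \<in> D" for u
    using Ck_on_imp_differentiable[OF n _ that] Ck_on_imp_differentiable[OF assms(3) _ that] by simp_all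
  have "Ck_on 1 (partial i (\<lambda>u. n u \<bullet> Y u)) D" for i
  proof (rule Ck_on_cong[OF assms(1)])
    show "Ck_on 1 (\<lambda>u. partial i n u \<bullet> Y u) D"
      by (rule Ck_on_inner[OF assms(1) Ck_on_partial[OF n] assms(3)])
    show "partial i n u \<bullet> Y u = partial i (\<lambda>u. n u \<bullet> Y u) u" if "u \<in> D" for u
      using partial_inner[OF d[OF that]] assms(4)[OF that] by simp
  qed
  then have "Ck_on (Suc 1) (\<lambda>u. n u \<bullet> Y u) D"
    using d by (auto intro!: bounded_bilinear.differentiable[OF bounded_bilinear_inner])
  then show ?thesis
    by (simp only: Suc_1)
qed

section \<open>Charts\<close>

lemma in_chart_image:
  assumes "is_chart M c" "p \<in> fst c"
  shows "inv_into (fst c) (snd c) (snd c p) = p" "in_chart c f (snd c p) = f p"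
proof -
  have "fst c \<subseteq> topspace M"
    using assms(1) by (simp add: is_chart_def openin_subset)
  then have "inj_on (snd c) (fst c)"
    using assms(1) homeomorphic_imp_injective_map unfolding is_chart_def
    by (metis topspace_subtopology_subset)
  then show "inv_into (fst c) (snd c) (snd c p) = p"
    using assms(2) by simp
  then show "in_chart c f (snd c p) = f p"
    by (simp add: in_chart_def)
qed

lemma openin_chart_preimage:
  assumes "is_chart M c" "open E"
  shows "openin M {p \<in> fst c. snd c p \<in> E}"
proof -
  let ?D = "snd c ` fst c"
  have U: "openin M (fst c)" and "fst c \<subseteq> topspace M"
    using assms(1) by (auto simp: is_chart_def openin_subset)
  have "continuous_map (subtopology M (fst c)) (top_of_set ?D) (snd c)"
    using assms(1) homeomorphic_imp_continuous_map by (auto simp: is_chart_def)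
  moreover have "openin (top_of_set ?D) (?D \<inter> E)"
    using assms(2) by (simp add: openin_open_Int)
  ultimately have "openin (subtopology M (fst c)) {p \<in> topspace (subtopology M (fst c)). snd c p \<in> ?D \<inter> E}"
    by (rule openin_continuous_map_preimage)
  also have "{p \<in> topspace (subtopology M (fst c)). snd c p \<in> ?D \<inter> E} = {p \<in> fst c. snd c p \<in> E}"
    using \<open>fst c \<subseteq> topspace M\<close> by (auto simp: topspace_subtopology_subset)
  finally show ?thesis
    using U openin_trans_full by blast
qed

lemma open_chart_image:
  assumes "is_chart M c" "openin M V"
  shows "open (snd c ` (fst c \<inter> V))"
proof -
  have "openin (subtopology M (fst c)) (fst c \<inter> V)"
    using assms(2) by (simp add: openin_subtopology_Int2)
  moreover have "open_map (subtopology M (fst c)) (top_of_set (snd c ` fst c)) (snd c)"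
    using assms(1) by (simp add: is_chart_def homeomorphic_imp_open_map)
  ultimately have "openin (top_of_set (snd c ` fst c)) (snd c ` (fst c \<inter> V))"
    by (simp add: open_map_def)
  then show ?thesis
    using assms(1) openin_open_trans by (auto simp: is_chart_def)
qed

lemma continuous_on_in_chart:
  assumes "is_chart M c" "continuous_map M euclidean f"
  shows "continuous_on (snd c ` fst c) (in_chart c f)"
proof -
  let ?D = "snd c ` fst c" and ?M = "subtopology M (fst c)"
  have "fst c \<subseteq> topspace M"
    using assms(1) by (simp add: is_chart_def openin_subset)
  then have top: "topspace ?M = fst c"
    by (rule topspace_subtopology_subset)
  obtain g where g: "homeomorphic_maps ?M (top_of_set ?D) (snd c) g"
    using assms(1) by (auto simp: is_chart_def homeomorphic_map_maps)
  have "continuous_map (top_of_set ?D) ?M g"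
    using g by (simp add: homeomorphic_maps_def)
  moreover have "continuous_map ?M euclidean f"
    using assms(2) by (rule continuous_map_from_subtopology)
  ultimately have "continuous_map (top_of_set ?D) euclidean (f \<circ> g)"
    by (rule continuous_map_compose)
  moreover have "(f \<circ> g) u = in_chart c f u" if u: "u \<in> ?D" for u
  proof -
    obtain p where p: "p \<in> fst c" "u = snd c p"
      using u by blast
    then have "g u = p"
      using g top by (simp add: homeomorphic_maps_def)
    then show ?thesis
      using p by (simp add: in_chart_image(2)[OF assms(1)])
  qed
  ultimately show ?thesis
    using continuous_on_eq[of ?D "f \<circ> g"] by simp
qed

lemma continuous_map_charts:
  fixes f :: "'a \<Rightarrow> 'b::topological_space"
  assumes "oriented_atlas r M A" "\<And>c. c \<in> A \<Longrightarrow> continuous_on (snd c ` fst c) (in_chart c f)"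
  shows "continuous_map M euclidean f"
  unfolding continuous_map_def
proof (intro conjI allI impI)
  fix W :: "'b set" assume "openin euclidean W"
  then have W: "open W"
    by simp
  have chart: "is_chart M c" if "c \<in> A" for c
    using assms(1) that by (simp add: oriented_atlas_def)
  have "{p \<in> fst c. snd c p \<in> snd c ` fst c \<inter> in_chart c f -` W} = {p \<in> fst c. f p \<in> W}" if "c \<in> A" for c
    by (intro Collect_cong conj_cong refl) (simp add: in_chart_image(2)[OF chart[OF that]])
  moreover have "topspace M = (\<Union>c\<in>A. fst c)"
    using assms(1) by (simp add: oriented_atlas_def)
  ultimately have "{p \<in> topspace M. f p \<in> W} = (\<Union>c\<in>A. {p \<in> fst c. snd c p \<in> snd c ` fst c \<inter> in_chart c f -` W})"
    by auto
  moreover have "openin M {p \<in> fst c. snd c p \<in> snd c ` fst c \<inter> in_chart c f -` W}" if "c \<in> A" for c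
  proof (rule openin_chart_preimage)
    show "is_chart M c"
      using that by (rule chart)
    then show "open (snd c ` fst c \<inter> in_chart c f -` W)"
      using assms(2)[OF that] W by (intro continuous_open_preimage) (auto simp: is_chart_def)
  qed
  ultimately show "openin M {p \<in> topspace M. f p \<in> W}"
    by auto
qed simp

section \<open>An ovaloid in a chart\<close>

lemma gram_det: "(norm (cross3 a b))\<^sup>2 = (a \<bullet> a) * (b \<bullet> b) - (a \<bullet> b) * (a \<bullet> b)"
  using norm_cross_dot[of a b]
  by (simp add: power_mult_distrib power2_norm_eq_inner[of a] power2_norm_eq_inner[of b] power2_eq_square[of "a \<bullet> b"])

text \<open>Order four is two plus two: the second fundamental form contains second derivatives of
  x, and the curvature of a metric differentiates it twice.\<close>

locale ovaloid_chart =
  fixes r M A x \<xi> and c :: "'a chart"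
  assumes ovaloid: "ovaloid r M A x \<xi>" and r: "r \<ge> 4" and chart: "c \<in> A"
begin

definition "D = snd c ` fst c"
definition "X = in_chart c x"
definition "n = in_chart c \<xi>"

definition h :: "real^2 \<Rightarrow> real^2^2" where
  "h u = (\<chi> i j. n u \<bullet> partial j (partial i X) u)"

lemma is_chart: "is_chart M c"
  using ovaloid chart by (auto simp: ovaloid_def closed_oriented_surface_def oriented_atlas_def)

lemma open_D: "open D"
  using is_chart by (simp add: is_chart_def D_def)

lemma D_obtain:
  assumes "u \<in> D"
  obtains p where "p \<in> fst c" "u = snd c p"
  using assms by (auto simp: D_def)

lemma fst_subset: "fst c \<subseteq> topspace M"
  using is_chart by (simp add: is_chart_def openin_subset)

lemma C4_X: "Ck_on 4 X D"
proof -
  have "Ck_on r X D"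
    using ovaloid chart by (simp add: ovaloid_def Ck_immersion_def Ck_map_def X_def D_def)
  then show ?thesis
    using r by (rule Ck_on_mono)
qed

lemma normal_field: "unit_normal_field M A x \<xi>"
  using ovaloid by (simp add: ovaloid_def)

lemma continuous_n: "continuous_on D n"
  using continuous_on_in_chart[OF is_chart, of \<xi>] normal_field
  by (simp add: unit_normal_field_def D_def n_def)

lemma unit_n: "u \<in> D \<Longrightarrow> norm (n u) = 1"
  using normal_field fst_subset
  by (elim D_obtain) (auto simp: unit_normal_field_def n_def in_chart_image(2)[OF is_chart])

lemma normal_n: "u \<in> D \<Longrightarrow> n u \<bullet> partial i X u = 0"
  using normal_field chart
  by (elim D_obtain) (auto simp: unit_normal_field_def D1_def n_def X_def in_chart_image(2)[OF is_chart])

lemma second_form_eq: "p \<in> fst c \<Longrightarrow> second_form c x \<xi> p = h (snd c p)"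
  by (simp add: second_form_def D2_def h_def n_def X_def in_chart_image(2)[OF is_chart])

lemma det_first_form:
  "p \<in> fst c \<Longrightarrow> det (first_form c x p) = (norm (cross3 (partial 1 X (snd c p)) (partial 2 X (snd c p))))\<^sup>2"
  by (simp add: first_form_def det_2 D1_def X_def gram_det inner_commute)

text \<open>By Lagrange's identity the Gaussian curvature is \<open>det (h u)\<close> over a square.
  Division by zero gives 0, so a positive quotient forces a nonzero denominator as well as a
  positive numerator.\<close>

lemma regular_and_det_h:
  assumes "u \<in> D"
  shows "cross3 (partial 1 X u) (partial 2 X u) \<noteq> 0" "det (h u) > 0"
proof -
  obtain p where p: "p \<in> fst c" "u = snd c p"
    using assms by (rule D_obtain)
  have "gauss_curvature c x \<xi> p > 0"
    using ovaloid chart p(1) by (simp add: ovaloid_def)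
  then have "det (h u) / (norm (cross3 (partial 1 X u) (partial 2 X u)))\<^sup>2 > 0"
    by (simp only: gauss_curvature_def det_first_form[OF p(1)] second_form_eq[OF p(1)] p(2))
  then show "cross3 (partial 1 X u) (partial 2 X u) \<noteq> 0" "det (h u) > 0"
    by (auto simp: zero_less_divide_iff not_less)
qed

lemma C3_n: "Ck_on 3 n D"
proof (rule Ck_on_normal[OF open_D _ continuous_n unit_n normal_n regular_and_det_h(1)])
  show "Ck_on (Suc 3) X D"
    using C4_X by simp
qed

lemma C2_h: "Ck_on 2 (\<lambda>u. h u $ i $ j) D"
proof -
  have "Ck_on (Suc (Suc 2)) X D"
    using C4_X by simp
  then have "Ck_on 2 (partial j (partial i X)) D"
    by (intro Ck_on_partial)
  moreover have "Ck_on 2 n D"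
    using C3_n by (rule Ck_on_mono) simp
  ultimately show ?thesis
    unfolding h_def by (simp add: Ck_on_inner[OF open_D])
qed

text \<open>Height functions reduce vector-valued statements to scalar ones: for w frozen to the
  normal at u, the Hessian at u is the second fundamental form, whose symmetry and transformation
  law follow from those of scalar Hessians.\<close>

lemma partial_inner_X:
  assumes "u \<in> D"
  shows "Ck_on 2 (\<lambda>v. w \<bullet> X v) D" "partial i (\<lambda>v. w \<bullet> X v) u = w \<bullet> partial i X u"
    "partial j (partial i (\<lambda>v. w \<bullet> X v)) u = w \<bullet> partial j (partial i X) u"
proof -
  have lin: "bounded_linear (\<lambda>z. w \<bullet> z)"
    by (rule bounded_linear_inner_right)
  have X: "Ck_on (Suc (Suc 2)) X D"
    using C4_X by simp
  then have d: "X differentiable (at v)" "partial i X differentiable (at v)" if "v \<in> D" for v i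
    using that by (meson Ck_on.simps(2))+
  show "Ck_on 2 (\<lambda>v. w \<bullet> X v) D"
    by (intro bounded_linear.Ck_on[OF lin open_D] Ck_on_mono[OF X]) simp
  show "partial i (\<lambda>v. w \<bullet> X v) u = w \<bullet> partial i X u"
    by (rule bounded_linear.partial[OF lin d(1)[OF assms]])
  have "partial j (partial i (\<lambda>v. w \<bullet> X v)) u = partial j (\<lambda>v. w \<bullet> partial i X v) u"
    by (rule partial_cong[OF open_D assms]) (rule bounded_linear.partial[OF lin d(1)])
  then show "partial j (partial i (\<lambda>v. w \<bullet> X v)) u = w \<bullet> partial j (partial i X) u"
    by (simp add: bounded_linear.partial[OF lin d(2)[OF assms]])
qed

lemma symmetric_h: "u \<in> D \<Longrightarrow> h u $ 2 $ 1 = h u $ 1 $ 2"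
  using partial_commute[OF open_D partial_inner_X(1), of u u "n u"] by (simp add: partial_inner_X h_def)

text \<open>The leading entry of the inverse of a 2x2 matrix is its lower diagonal entry over the
  determinant, so ellipticity asks for the sign of this entry rather than of the first one.\<close>

lemma h_11_22:
  assumes "u \<in> D" "0 < \<epsilon> * h u $ 1 $ 1"
  shows "0 < \<epsilon> * h u $ 2 $ 2" 
proof -
  have "(h u $ 1 $ 2)\<^sup>2 < h u $ 1 $ 1 * h u $ 2 $ 2"
    using regular_and_det_h(2)[OF assms(1)] symmetric_h[OF assms(1)] by (simp add: det_2 power2_eq_square)
  then have "0 < h u $ 1 $ 1 * h u $ 2 $ 2"
    using zero_le_power2[of "h u $ 1 $ 2"] by linarith
  then show ?thesis
    using assms(2) by (auto simp: zero_less_mult_iff)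
qed

end

locale normalized_ovaloid_chart = ovaloid_chart +
  fixes s y
  assumes s: "s \<ge> 1" and normalization: "relative_normalization s A x y"
    and positive: "\<And>p. p \<in> fst c \<Longrightarrow> support_function \<xi> y p > 0"
begin

definition "q = in_chart c (support_function \<xi> y)"

lemma q_pos: "u \<in> D \<Longrightarrow> q u > 0"
  using positive by (elim D_obtain) (simp add: q_def in_chart_image(2)[OF is_chart])

lemma C2_q: "Ck_on 2 q D"
proof -
  let ?Y = "in_chart c y"
  have "Ck_on s ?Y D"
    using normalization chart by (simp add: relative_normalization_def Ck_map_def D_def)
  then have "Ck_on 1 ?Y D"
    using s by (rule Ck_on_mono)
  moreover have "n u \<bullet> partial i ?Y u = 0" if u: "u \<in> D" for u i
  proof -
    obtain p where p: "p \<in> fst c" "u = snd c p"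
      using u by (rule D_obtain)
    then have "partial i ?Y u \<in> span {partial 1 X u, partial 2 X u}"
      using normalization chart by (simp add: relative_normalization_def D1_def X_def)
    then have "orthogonal (n u) (partial i ?Y u)"
      by (rule orthogonal_to_span) (use normal_n[OF u] in \<open>auto simp: orthogonal_def\<close>)
    then show ?thesis
      by (simp add: orthogonal_def)
  qed
  moreover have "Ck_on 2 n D"
    using C3_n by (rule Ck_on_mono) simp
  ultimately have "Ck_on 2 (\<lambda>u. n u \<bullet> ?Y u) D"
    by (intro Ck_on_support open_D)
  moreover have "(\<lambda>u. n u \<bullet> ?Y u) = q"
    by (simp add: fun_eq_iff n_def q_def in_chart_def support_function_def)
  ultimately show ?thesis
    by simp
qed

lemma relative_metric_eq:
  assumes "u \<in> D"
  shows "in_chart c (relative_metric c x \<xi> y) u = inverse (q u) *\<^sub>R h u"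
proof -
  obtain p where "p \<in> fst c" "u = snd c p"
    using assms by (rule D_obtain)
  then have "in_chart c (relative_metric c x \<xi> y) u $ i $ j = (inverse (q u) *\<^sub>R h u) $ i $ j" for i j
    by (simp add: relative_metric_def covector_def D2_def h_def n_def X_def q_def
        in_chart_image(2)[OF is_chart])
  then show ?thesis
    by (simp add: vec_eq_iff)
qed

sublocale metric_on D "\<lambda>u. inverse (q u) *\<^sub>R h u"
proof
  show "Ck_on 2 (\<lambda>v. (inverse (q v) *\<^sub>R h v) $ i $ j) D" for i j
    by (simp add: Ck_on_mult[OF open_D Ck_on_inverse[OF open_D C2_q q_pos] C2_h])
  show "det (inverse (q u) *\<^sub>R h u) > 0" if "u \<in> D" for u
    using q_pos[OF that] regular_and_det_h(2)[OF that] by (simp add: det_scaleR_2)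
qed (simp_all add: open_D symmetric_h)

end

section \<open>Comparison of two normalizations in one chart\<close>

locale two_normalizations =
  first: normalized_ovaloid_chart r M A x \<xi> c s y + second: normalized_ovaloid_chart r M A x \<xi> c t z
  for r M A x \<xi> c s y t z
begin

text \<open>The negative of \<phi> from the overview, with z in the role of the equiaffine
  normalization: the metric of y is exp \<mu> times the metric of z.\<close>

definition "\<mu> u = ln (second.q u) - ln (first.q u)"

lemma C2_\<mu>: "Ck_on 2 \<mu> first.D"
  unfolding \<mu>_def[abs_def]
  by (intro Ck_on_diff Ck_on_ln first.open_D first.C2_q second.C2_q first.q_pos second.q_pos)

text \<open>In dimension two, dividing by the support function cancels the conformal factor, and only the
  Laplacian of its logarithm remains.\<close>

lemma scalar_curvature_difference:
  assumes "p \<in> fst c"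
  shows "relative_scalar_curvature c x \<xi> y p / support_function \<xi> y p
      - relative_scalar_curvature c x \<xi> z p / support_function \<xi> z p
    = - laplacian (\<lambda>u. inverse (second.q u) *\<^sub>R first.h u) \<mu> (snd c p) / (2 * support_function \<xi> z p)"
proof -
  let ?u = "snd c p" and ?g = "\<lambda>u. inverse (second.q u) *\<^sub>R first.h u"
  let ?S = "scalar_curvature ?g ?u" and ?L = "laplacian ?g \<mu> ?u"
  have u: "?u \<in> first.D"
    using assms by (simp add: first.D_def)
  have q: "first.q ?u = support_function \<xi> y p" "second.q ?u = support_function \<xi> z p"
    using assms by (simp_all add: first.q_def second.q_def in_chart_image(2)[OF first.is_chart])
  have pos: "first.q u > 0" "second.q u > 0" if "u \<in> first.D" for u
    using that by (rule first.q_pos second.q_pos)+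
  have exp_\<mu>: "exp (\<mu> u) = second.q u / first.q u" if "u \<in> first.D" for u
    using pos[OF that] by (simp add: \<mu>_def exp_diff)
  have "relative_scalar_curvature c x \<xi> y p = scalar_curvature (\<lambda>v. exp (\<mu> v) *\<^sub>R ?g v) ?u"
    unfolding relative_scalar_curvature_def
  proof (rule scalar_curvature_cong[OF first.open_D u])
    fix v assume v: "v \<in> first.D"
    then show "in_chart c (relative_metric c x \<xi> y) v = exp (\<mu> v) *\<^sub>R ?g v"
      using pos[OF v] by (simp add: first.relative_metric_eq exp_\<mu> divide_inverse)
  qed
  also have "\<dots> = exp (- \<mu> ?u) * (?S - 1/2 * ?L)"
    by (rule second.scalar_curvature_conformal[OF u C2_\<mu>])
  also have "exp (- \<mu> ?u) = first.q ?u / second.q ?u"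
    using exp_\<mu>[OF u] by (simp add: exp_minus)
  finally have y: "relative_scalar_curvature c x \<xi> y p = first.q ?u / second.q ?u * (?S - 1/2 * ?L)" .
  have z: "relative_scalar_curvature c x \<xi> z p = ?S"
    unfolding relative_scalar_curvature_def
    by (rule scalar_curvature_cong[OF first.open_D u second.relative_metric_eq])
  have cancel: "a / b * (k - 1/2 * l) / a - k / b = - l / (2 * b)" if "a > 0" "b > 0" for a b k l :: real
    using that by (simp add: field_simps)
  show ?thesis
    unfolding y z q[symmetric] by (rule cancel[OF pos[OF u]])
qed

text \<open>Here $\varepsilon$ is the sign of the second fundamental form, so that $\varepsilon g^{-1}$ is
  elliptic, and $\sigma$ is the sign of $S/q - S_{\mathrm{aff}}/q_{\mathrm{aff}}$.\<close>

lemma locally_constant: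
  assumes "\<epsilon> = 1 \<or> \<epsilon> = (-1::real)" "\<And>u. u \<in> first.D \<Longrightarrow> 0 < \<epsilon> * first.h u $ 1 $ 1"
    and "\<And>p. p \<in> fst c \<Longrightarrow> 0 \<le> \<sigma> * (relative_scalar_curvature c x \<xi> y p / support_function \<xi> y p
      - relative_scalar_curvature c x \<xi> z p / support_function \<xi> z p)"
    and "u \<in> first.D" "\<And>v. v \<in> first.D \<Longrightarrow> - (\<epsilon> * \<sigma>) * \<mu> v \<le> - (\<epsilon> * \<sigma>) * \<mu> u"
  obtains E where "open E" "u \<in> E" "E \<subseteq> first.D" "\<And>v. v \<in> E \<Longrightarrow> - (\<epsilon> * \<sigma>) * \<mu> v = - (\<epsilon> * \<sigma>) * \<mu> u"
proof -
  let ?g = "\<lambda>u. inverse (second.q u) *\<^sub>R first.h u"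
  define a where "a u i j = \<epsilon> * matrix_inv (?g u) $ i $ j" for u i j
  \<comment> \<open>The contracted Christoffel symbols are the drift for which the elliptic operator
    is \<epsilon> times the Laplacian.\<close>
  define b where "b u k = - (\<Sum>i\<in>UNIV. \<Sum>j\<in>UNIV. a u i j * christoffel ?g k i j u)" for u k
  have det: "det (?g u) \<noteq> 0" if "u \<in> first.D" for u
    using second.det_pos[OF that] by simp
  have a_entries: "a u 1 1 = \<epsilon> * first.h u $ 2 $ 2 * (inverse (second.q u) * inverse (det (?g u)))"
    "a u 2 2 = \<epsilon> * first.h u $ 1 $ 1 * (inverse (second.q u) * inverse (det (?g u)))"
    "a u 1 2 = - \<epsilon> * first.h u $ 1 $ 2 * (inverse (second.q u) * inverse (det (?g u)))"
    "a u 2 1 = - \<epsilon> * first.h u $ 2 $ 1 * (inverse (second.q u) * inverse (det (?g u)))" if "u \<in> first.D" for u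
    unfolding a_def matrix_inv_2[OF det[OF that]] by simp_all
  have cont_a: "continuous_on first.D (\<lambda>u. a u i j)" for i j
    unfolding a_def by (intro continuous_intros Ck_on_imp_continuous_on[OF second.C1_matrix_inv])
  have cont_b: "continuous_on first.D (\<lambda>u. b u k)" for k
    unfolding b_def
    by (intro continuous_intros cont_a Ck_on_imp_continuous_on[OF second.C1_christoffel])
  have pos: "0 < a u 1 1" "0 < a u 1 1 * a u 2 2 - a u 1 2 * a u 1 2" "a u 2 1 = a u 1 2" if u: "u \<in> first.D" for u
  proof -
    let ?k = "inverse (second.q u) * inverse (det (?g u))"
    have k: "?k > 0"
      using second.q_pos[OF u] second.det_pos[OF u] by simp
    show "0 < a u 1 1"
      unfolding a_entries[OF u] using first.h_11_22[OF u assms(2)[OF u]] k by (rule mult_pos_pos)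
    have "a u 1 1 * a u 2 2 - a u 1 2 * a u 1 2 = (\<epsilon> * \<epsilon>) * (?k * ?k) * det (first.h u)"
      unfolding a_entries[OF u] det_2[of "first.h u"] first.symmetric_h[OF u] by (simp only: algebra_simps)
    also have "\<dots> > 0"
    proof -
      have "\<epsilon> * \<epsilon> > 0"
        using assms(1) by auto
      from mult_pos_pos[OF mult_pos_pos[OF this mult_pos_pos[OF k k]] first.regular_and_det_h(2)[OF u]]
      show ?thesis .
    qed
    finally show "0 < a u 1 1 * a u 2 2 - a u 1 2 * a u 1 2" .
    show "a u 2 1 = a u 1 2"
      unfolding a_entries[OF u] first.symmetric_h[OF u] ..
  qed
  \<comment> \<open>The zero summand brings f into the form f + k * g of
    \<open>elliptic_operator_linear\<close>, which then yields homogeneity.\<close>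
  define f where "f v = 0 + (- (\<epsilon> * \<sigma>)) * \<mu> v" for v
  have C0: "Ck_on 2 (\<lambda>v. 0 :: real) first.D"
    by (rule Ck_on_const)
  have f: "Ck_on 2 f first.D"
    unfolding f_def by (intro Ck_on_add Ck_on_mult Ck_on_const C2_\<mu> first.open_D)
  have expand: "(\<Sum>i\<in>UNIV. \<Sum>j\<in>UNIV. \<epsilon> * m i j * H j i) + (\<Sum>k\<in>UNIV. - (\<Sum>i\<in>UNIV. \<Sum>j\<in>UNIV. \<epsilon> * m i j * G k i j) * P k)
      = \<epsilon> * (\<Sum>i\<in>UNIV. \<Sum>j\<in>UNIV. m i j * (H j i - (\<Sum>k\<in>UNIV. G k i j * P k)))"
    for m H :: "2 \<Rightarrow> 2 \<Rightarrow> real" and G :: "2 \<Rightarrow> 2 \<Rightarrow> 2 \<Rightarrow> real" and P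
    by (simp add: sum_2 algebra_simps)
  have sub: "0 \<le> elliptic_operator a b f u" if u: "u \<in> first.D" for u
  proof -
    obtain p where p: "p \<in> fst c" "u = snd c p"
      using u by (rule first.D_obtain)
    have "partial i (\<lambda>v. 0 :: real) = (\<lambda>v. 0)" for i
      by (simp add: fun_eq_iff)
    then have "elliptic_operator a b (\<lambda>v. 0) u = 0"
      by (simp add: elliptic_operator_def)
    then have "elliptic_operator a b f u = - (\<epsilon> * \<sigma>) * elliptic_operator a b \<mu> u"
      unfolding f_def elliptic_operator_linear[OF first.open_D C0 C2_\<mu> u] by simp
    also have "elliptic_operator a b \<mu> u = \<epsilon> * laplacian ?g \<mu> u"
      unfolding elliptic_operator_def laplacian_def b_def a_def by (rule expand)
    also have "laplacian ?g \<mu> u = - (2 * support_function \<xi> z p) * (relative_scalar_curvature c x \<xi> y p / support_function \<xi> y p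
      - relative_scalar_curvature c x \<xi> z p / support_function \<xi> z p)"
      unfolding scalar_curvature_difference[OF p(1)] p(2) using second.positive[OF p(1)] by simp
    \<comment> \<open>The factor \<epsilon> of the function and that of the operator multiply to 1,
      so only \<sigma> times the given difference survives, with a positive weight.\<close>
    also have "- (\<epsilon> * \<sigma>) * (\<epsilon> * (- (2 * support_function \<xi> z p) * (relative_scalar_curvature c x \<xi> y p / support_function \<xi> y p
      - relative_scalar_curvature c x \<xi> z p / support_function \<xi> z p)))
      = 2 * support_function \<xi> z p * (\<sigma> * (relative_scalar_curvature c x \<xi> y p / support_function \<xi> y p
      - relative_scalar_curvature c x \<xi> z p / support_function \<xi> z p))"
      using assms(1) by auto
    also have "\<dots> \<ge> 0"
      by (rule mult_nonneg_nonneg[OF _ assms(3)[OF p(1)]]) (use second.positive[OF p(1)] in simp)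
    finally show ?thesis .
  qed
  have max: "f v \<le> f u" if "v \<in> first.D" for v
    using assms(5)[OF that] by (simp only: f_def add_0)
  show ?thesis
  proof (rule strong_maximum_principle[where a = a and b = b, OF first.open_D f cont_a cont_b pos sub assms(4) max])
    fix E assume "open E" "u \<in> E" "E \<subseteq> first.D" and E: "\<And>v. v \<in> E \<Longrightarrow> f v = f u"
    then show ?thesis
      by (intro that[of E] E[unfolded f_def add_0])
  qed
qed

end

section \<open>Change of charts\<close>

lemma partial_compose:
  fixes f :: "real^2 \<Rightarrow> 'b::real_normed_vector" and \<tau> :: "real^2 \<Rightarrow> real^2"
  assumes "\<tau> differentiable (at w)" "f differentiable (at (\<tau> w))"
  shows "partial i (\<lambda>w. f (\<tau> w)) w
    = (partial i \<tau> w $ 1) *\<^sub>R partial 1 f (\<tau> w) + (partial i \<tau> w $ 2) *\<^sub>R partial 2 f (\<tau> w)"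
  using partial_eqI[OF diff_chain_at[OF assms(1)[unfolded frechet_derivative_works]
        frechet_derivative_partial[OF assms(2)]], of i]
  by (simp add: o_def partial_def)

text \<open>Second derivatives of \<tau> are multiplied by first derivatives of f, which vanish at a
  critical point; what remains is the transformation law of a bilinear form.\<close>

lemma hessian_compose_critical:
  fixes f :: "real^2 \<Rightarrow> real" and \<tau> :: "real^2 \<Rightarrow> real^2"
  assumes "open W" "Ck_on 2 \<tau> W" "Ck_on 2 f D" "\<And>v. v \<in> W \<Longrightarrow> \<tau> v \<in> D"
    and "w \<in> W" "\<And>k. partial k f (\<tau> w) = 0"
  shows "partial j (partial i (\<lambda>w. f (\<tau> w))) w = (\<Sum>k\<in>UNIV. \<Sum>l\<in>UNIV.
    (partial i \<tau> w $ k) * (partial j \<tau> w $ l) * partial l (partial k f) (\<tau> w))"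
proof -
  have C: "Ck_on (Suc (Suc 0)) \<tau> W" "Ck_on (Suc (Suc 0)) f D"
    using assms(2,3) by (simp_all only: numeral_2_eq_2)
  have d\<tau>: "\<tau> differentiable (at v)" "partial i \<tau> differentiable (at v)" if "v \<in> W" for v i
    using C(1) that by (meson Ck_on.simps(2))+
  have df: "f differentiable (at v)" "partial i f differentiable (at v)" if "v \<in> D" for v i
    using C(2) that by (meson Ck_on.simps(2))+
  have w: "\<tau> w \<in> D"
    using assms(4,5) .
  have d1: "(\<lambda>v. partial i \<tau> v $ k) differentiable (at w)" for k
    using d\<tau>(2)[OF assms(5)] bounded_linear.has_derivative[OF bounded_linear_vec_nth]
    unfolding differentiable_def by blast
  have d2: "(\<lambda>v. partial k f (\<tau> v)) differentiable (at w)" for k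
    using differentiable_chain_at[OF d\<tau>(1)[OF assms(5)] df(2)[OF w]] by (simp add: o_def)
  have "partial j (partial i (\<lambda>w. f (\<tau> w))) w
    = partial j (\<lambda>v. (partial i \<tau> v $ 1) * partial 1 f (\<tau> v) + (partial i \<tau> v $ 2) * partial 2 f (\<tau> v)) w"
    by (rule partial_cong[OF assms(1,5)]) (simp add: partial_compose d\<tau> df assms(4))
  also have "\<dots> = (partial i \<tau> w $ 1) * partial j (\<lambda>v. partial 1 f (\<tau> v)) w
      + (partial i \<tau> w $ 2) * partial j (\<lambda>v. partial 2 f (\<tau> v)) w"
    by (simp add: partial_add partial_mult differentiable_mult d1 d2 assms(6))
  finally have *: "partial j (partial i (\<lambda>w. f (\<tau> w))) w = (partial i \<tau> w $ 1) * partial j (\<lambda>v. partial 1 f (\<tau> v)) w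
      + (partial i \<tau> w $ 2) * partial j (\<lambda>v. partial 2 f (\<tau> v)) w" .
  have "partial j (\<lambda>v. partial k f (\<tau> v)) w
    = (\<Sum>l\<in>UNIV. (partial j \<tau> w $ l) * partial l (partial k f) (\<tau> w))" for k
    by (simp add: partial_compose[OF d\<tau>(1)[OF assms(5)] df(2)[OF w]] sum_2)
  then show ?thesis
    unfolding * by (simp add: sum_2 algebra_simps)
qed

text \<open>The height function in the direction of the normal at p is critical at p in both charts,
  so its Hessians there, the two second fundamental forms, are congruent through the Jacobian of the
  transition map. A definite form keeps its sign.\<close>

lemma second_form_sign:
  assumes "ovaloid_chart r M A x \<xi> c" "ovaloid_chart r M A x \<xi> d"
    and p: "p \<in> fst c" "p \<in> fst d" and pos: "0 < \<epsilon> * second_form c x \<xi> p $ 1 $ 1"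
  shows "0 < \<epsilon> * second_form d x \<xi> p $ 1 $ 1"
proof -
  interpret c: ovaloid_chart r M A x \<xi> c
    by fact
  interpret d: ovaloid_chart r M A x \<xi> d
    by fact
  define u w where "u = snd c p" and "w = snd d p"
  define \<tau> where "\<tau> = in_chart d (snd c)"
  define W where "W = snd d ` (fst d \<inter> fst c)"
  let ?f = "\<lambda>v. \<xi> p \<bullet> c.X v"
  have u: "u \<in> c.D" and w: "w \<in> W" and wD: "w \<in> d.D" and \<tau>w: "\<tau> w = u"
    using p by (auto simp: u_def w_def c.D_def d.D_def W_def \<tau>_def in_chart_image(2)[OF d.is_chart])
  have openW: "open W"
    unfolding W_def using c.is_chart by (intro open_chart_image[OF d.is_chart]) (simp add: is_chart_def)
  have "Ck_on r \<tau> W"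
    using c.ovaloid c.chart d.chart
    by (simp add: ovaloid_def closed_oriented_surface_def oriented_atlas_def \<tau>_def W_def)
  then have C\<tau>: "Ck_on 2 \<tau> W"
    by (rule Ck_on_mono) (use c.r in simp)
  have \<tau>: "\<tau> v \<in> c.D" "d.X v = c.X (\<tau> v)" if v: "v \<in> W" for v
  proof -
    obtain p' where "p' \<in> fst d" "p' \<in> fst c" "v = snd d p'"
      using v unfolding W_def by blast
    then show "\<tau> v \<in> c.D" "d.X v = c.X (\<tau> v)"
      by (simp_all add: \<tau>_def c.D_def c.X_def d.X_def in_chart_image(2)[OF d.is_chart] in_chart_image(2)[OF c.is_chart])
  qed
  have n: "c.n u = \<xi> p" "d.n w = \<xi> p"
    using p by (simp_all add: c.n_def d.n_def u_def w_def in_chart_image(2)[OF c.is_chart] in_chart_image(2)[OF d.is_chart])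
  have crit: "partial k ?f (\<tau> w) = 0" for k
    using c.partial_inner_X(2)[OF u] c.normal_n[OF u] n by (simp add: \<tau>w)
  have cong: "partial i (\<lambda>v. \<xi> p \<bullet> d.X v) v = partial i (\<lambda>v. ?f (\<tau> v)) v" if "v \<in> W" for i v
    by (rule partial_cong[OF openW that]) (simp add: \<tau>(2))
  have "d.h w $ 1 $ 1 = partial 1 (partial 1 (\<lambda>v. \<xi> p \<bullet> d.X v)) w"
    using d.partial_inner_X(3)[OF wD] n by (simp add: d.h_def)
  also have "\<dots> = partial 1 (partial 1 (\<lambda>v. ?f (\<tau> v))) w"
    by (rule partial_cong[OF openW w cong])
  also have "\<dots> = (\<Sum>k\<in>UNIV. \<Sum>l\<in>UNIV. (partial 1 \<tau> w $ k) * (partial 1 \<tau> w $ l) * c.h u $ k $ l)"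
    using c.partial_inner_X(3)[OF u] n
    by (simp add: hessian_compose_critical[OF openW C\<tau> c.partial_inner_X(1)[OF u] \<tau>(1) w crit] c.h_def \<tau>w)
  finally have eq: "\<epsilon> * d.h w $ 1 $ 1 = (\<epsilon> * c.h u $ 1 $ 1) * partial 1 \<tau> w $ 1 * partial 1 \<tau> w $ 1
      + (\<epsilon> * c.h u $ 1 $ 2) * partial 1 \<tau> w $ 1 * partial 1 \<tau> w $ 2
      + ((\<epsilon> * c.h u $ 1 $ 2) * partial 1 \<tau> w $ 2 * partial 1 \<tau> w $ 1
      + (\<epsilon> * c.h u $ 2 $ 2) * partial 1 \<tau> w $ 2 * partial 1 \<tau> w $ 2)"
    by (simp add: sum_2 c.symmetric_h[OF u] algebra_simps)
  \<comment> \<open>This shows that the first column of the Jacobian is nonzero: otherwise the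
    right-hand side of \<open>eq\<close> would vanish.\<close>
  have "d.h w $ 1 $ 1 \<noteq> 0"
    using d.regular_and_det_h(2)[OF wD] d.symmetric_h[OF wD] by (auto simp: det_2)
  then have "\<epsilon> * d.h w $ 1 $ 1 \<noteq> 0"
    using pos by auto
  then have "partial 1 \<tau> w $ 1 \<noteq> 0 \<or> partial 1 \<tau> w $ 2 \<noteq> 0"
    unfolding eq by auto
  moreover have "\<epsilon> * c.h u $ 1 $ 1 > 0"
    using pos c.second_form_eq[OF p(1)] by (simp add: u_def)
  moreover have "\<epsilon> * c.h u $ 1 $ 1 * (\<epsilon> * c.h u $ 2 $ 2) - \<epsilon> * c.h u $ 1 $ 2 * (\<epsilon> * c.h u $ 1 $ 2)
      = \<epsilon>\<^sup>2 * det (c.h u)"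
    by (simp add: det_2 c.symmetric_h[OF u] power2_eq_square algebra_simps)
  then have "\<epsilon> * c.h u $ 1 $ 1 * (\<epsilon> * c.h u $ 2 $ 2) - \<epsilon> * c.h u $ 1 $ 2 * (\<epsilon> * c.h u $ 1 $ 2) > 0"
    using c.regular_and_det_h(2)[OF u] pos by (auto simp: zero_less_mult_iff)
  ultimately have "\<epsilon> * d.h w $ 1 $ 1 > 0"
    unfolding eq by (intro elliptic_quadratic_pos)
  then show ?thesis
    using d.second_form_eq[OF p(2)] by (simp add: w_def)
qed

text \<open>As the determinant is positive, the first diagonal entry never vanishes and carries the
  sign of the whole form; it divides the surface into two disjoint open sets.\<close>

lemma second_form_definite:
  assumes ovaloid: "ovaloid r M A x \<xi>" and r: "r \<ge> 4"
  obtains \<epsilon> where "\<epsilon> = 1 \<or> \<epsilon> = (-1::real)"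
    "\<And>c p. c \<in> A \<Longrightarrow> p \<in> fst c \<Longrightarrow> 0 < \<epsilon> * second_form c x \<xi> p $ 1 $ 1"
proof -
  have chart: "ovaloid_chart r M A x \<xi> c" if "c \<in> A" for c
    using assms that by unfold_locales
  \<comment> \<open>One chart with the right sign is required, which makes openness immediate;
    \<open>second_form_sign\<close> passes the sign to every other chart around the point.\<close>
  define P where "P e = {p \<in> topspace M. \<exists>c\<in>A. p \<in> fst c \<and> 0 < e * second_form c x \<xi> p $ 1 $ 1}" for e :: real
  have cover: "topspace M = (\<Union>c\<in>A. fst c)"
    using ovaloid by (simp add: ovaloid_def closed_oriented_surface_def oriented_atlas_def)
  have open_P: "openin M (P e)" for e
  proof -
    have "openin M {p \<in> fst c. 0 < e * second_form c x \<xi> p $ 1 $ 1}" if "c \<in> A" for c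
    proof -
      interpret ovaloid_chart r M A x \<xi> c
        using that by (rule chart)
      have opn: "open (D \<inter> (\<lambda>u. e * h u $ 1 $ 1) -` {0<..})"
        by (intro continuous_open_preimage continuous_on_mult continuous_on_const
            Ck_on_imp_continuous_on[OF C2_h] open_D) auto
      have "{p \<in> fst c. snd c p \<in> D \<inter> (\<lambda>u. e * h u $ 1 $ 1) -` {0<..}}
          = {p \<in> fst c. 0 < e * second_form c x \<xi> p $ 1 $ 1}"
        by (intro Collect_cong conj_cong refl) (simp add: second_form_eq D_def)
      then show ?thesis
        using openin_chart_preimage[OF is_chart opn] by simp
    qed
    then have "openin M (\<Union>c\<in>A. {p \<in> fst c. 0 < e * second_form c x \<xi> p $ 1 $ 1})"
      by blast
    also have "(\<Union>c\<in>A. {p \<in> fst c. 0 < e * second_form c x \<xi> p $ 1 $ 1}) = P e"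
      using cover by (auto simp: P_def)
    finally show ?thesis .
  qed
  have nonzero: "second_form c x \<xi> p $ 1 $ 1 \<noteq> 0" if "c \<in> A" "p \<in> fst c" for c p
  proof -
    interpret ovaloid_chart r M A x \<xi> c
      using that(1) by (rule chart)
    have "snd c p \<in> D"
      using that by (simp add: D_def)
    then show ?thesis
      using regular_and_det_h(2) symmetric_h second_form_eq[OF that(2)] by (fastforce simp: det_2)
  qed
  have sign: "0 < e * second_form c x \<xi> p $ 1 $ 1" if "p \<in> P e" "c \<in> A" "p \<in> fst c" for c p e
  proof -
    obtain c' where "c' \<in> A" "p \<in> fst c'" "0 < e * second_form c' x \<xi> p $ 1 $ 1"
      using \<open>p \<in> P e\<close> unfolding P_def by blast
    then show ?thesis
      using second_form_sign[OF chart chart] that by blast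
  qed
  have "topspace M \<subseteq> P 1 \<union> P (- 1)"
  proof
    fix p assume p: "p \<in> topspace M"
    then obtain c where "c \<in> A" "p \<in> fst c"
      using cover by blast
    then show "p \<in> P 1 \<union> P (- 1)"
      using nonzero[of c p] p by (force simp: P_def)
  qed
  moreover have "P 1 \<inter> P (- 1) = {}"
  proof -
    have False if "p \<in> P 1" "p \<in> P (- 1)" for p
    proof -
      obtain c where c: "c \<in> A" "p \<in> fst c"
        using \<open>p \<in> P 1\<close> by (auto simp: P_def)
      show False
        using sign[OF that(1) c] sign[OF that(2) c] by simp
    qed
    then show ?thesis
      by blast
  qed
  moreover have "connected_space M"
    using ovaloid by (simp add: ovaloid_def closed_oriented_surface_def)
  ultimately have "P 1 = {} \<or> P (- 1) = {}"
    using open_P unfolding connected_space_def by blast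
  then obtain \<epsilon> where \<epsilon>: "\<epsilon> = 1 \<or> \<epsilon> = (-1::real)" "topspace M \<subseteq> P \<epsilon>"
    using \<open>topspace M \<subseteq> P 1 \<union> P (- 1)\<close> by auto
  show ?thesis
  proof (rule that[OF \<epsilon>(1)])
    fix c p assume "c \<in> A" "p \<in> fst c"
    then show "0 < \<epsilon> * second_form c x \<xi> p $ 1 $ 1"
      using \<epsilon>(2) cover by (intro sign) auto
  qed
qed

section \<open>From charts to the whole surface\<close>

theorem proposition4p4:
  fixes M :: "'a topology" and A :: "'a chart set"
    and x \<xi> y y_aff :: "'a \<Rightarrow> real^3"
    and r s t :: nat
    and F :: "'a chart \<Rightarrow> 'a \<Rightarrow> real"
  assumes "r \<ge> 4"
    and "ovaloid r M A x \<xi>"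
    and "1 \<le> s" "s < r" "relative_normalization s A x y"
    and "\<forall>p\<in>topspace M. support_function \<xi> y p > 0"
    and "1 \<le> t" "t < r" "equiaffine_normalization t A x \<xi> y_aff"
    and "F = (\<lambda>c p. relative_scalar_curvature c x \<xi> y p / support_function \<xi> y p
                  - relative_scalar_curvature c x \<xi> y_aff p / support_function \<xi> y_aff p)"
    and "(\<forall>c\<in>A. \<forall>p\<in>fst c. 0 \<le> F c p) \<or> (\<forall>c\<in>A. \<forall>p\<in>fst c. F c p \<le> 0)"
  shows "constantly_proportional M \<xi> y y_aff"
proof -
  have surface: "oriented_atlas r M A" "compact_space M" "connected_space M" "topspace M \<noteq> {}"
    using assms(2) by (auto simp: ovaloid_def closed_oriented_surface_def)
  then have cover: "topspace M = (\<Union>c\<in>A. fst c)"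
    by (simp add: oriented_atlas_def)
  have q_aff: "support_function \<xi> y_aff p > 0" if "c \<in> A" "p \<in> fst c" for c p
  proof -
    have "gauss_curvature c x \<xi> p > 0"
      using assms(2) that by (simp add: ovaloid_def)
    then show ?thesis
      using assms(9) that by (simp add: equiaffine_normalization_def)
  qed
  have charts: "two_normalizations r M A x \<xi> c s y t y_aff" if "c \<in> A" for c
    using assms that cover q_aff by unfold_locales (auto simp: equiaffine_normalization_def)
  obtain \<epsilon> where \<epsilon>: "\<epsilon> = 1 \<or> \<epsilon> = (-1::real)"
    "\<And>c p. c \<in> A \<Longrightarrow> p \<in> fst c \<Longrightarrow> 0 < \<epsilon> * second_form c x \<xi> p $ 1 $ 1"
    using second_form_definite[OF assms(2,1)] by metis
  obtain \<sigma> where \<sigma>: "\<sigma> = 1 \<or> \<sigma> = (-1::real)" "\<And>c p. c \<in> A \<Longrightarrow> p \<in> fst c \<Longrightarrow> 0 \<le> \<sigma> * F c p"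
  proof -
    have "\<exists>\<sigma>. (\<sigma> = 1 \<or> \<sigma> = (-1::real)) \<and> (\<forall>c\<in>A. \<forall>p\<in>fst c. 0 \<le> \<sigma> * F c p)"
      using assms(11)
    proof
      assume "\<forall>c\<in>A. \<forall>p\<in>fst c. 0 \<le> F c p"
      then show ?thesis
        by (intro exI[of _ 1]) simp
    next
      assume "\<forall>c\<in>A. \<forall>p\<in>fst c. F c p \<le> 0"
      then show ?thesis
        by (intro exI[of _ "-1"]) simp
    qed
    then show ?thesis
      using that by blast
  qed
  \<comment> \<open>The sign is such that the elliptic operator of every chart is nonnegative on
    \<rho>, so that all four combinations of \<epsilon> and \<sigma> are settled at a
    maximum.\<close>
  define \<rho> where "\<rho> p = - (\<epsilon> * \<sigma>) * (ln (support_function \<xi> y_aff p) - ln (support_function \<xi> y p))" for p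
  have in_chart_\<rho>: "in_chart c \<rho> = (\<lambda>u. - (\<epsilon> * \<sigma>) * two_normalizations.\<mu> \<xi> c y y_aff u)" if "c \<in> A" for c
  proof -
    interpret two_normalizations r M A x \<xi> c s y t y_aff
      using that by (rule charts)
    show ?thesis
      by (simp add: fun_eq_iff in_chart_def \<rho>_def \<mu>_def first.q_def second.q_def)
  qed
  have cont: "continuous_map M euclidean \<rho>"
  proof (rule continuous_map_charts[OF surface(1)])
    fix c assume c: "c \<in> A"
    interpret two_normalizations r M A x \<xi> c s y t y_aff
      using c by (rule charts)
    show "continuous_on (snd c ` fst c) (in_chart c \<rho>)"
      unfolding in_chart_\<rho>[OF c] using Ck_on_imp_continuous_on[OF C2_\<mu>]
      by (intro continuous_on_mult continuous_on_const) (simp add: first.D_def)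
  qed
  have "compact (\<rho> ` topspace M)"
    using image_compactin[OF _ cont] surface(2) by (auto simp: compact_space_def)
  then obtain p\<^sub>0 where p\<^sub>0: "p\<^sub>0 \<in> topspace M" "\<And>p. p \<in> topspace M \<Longrightarrow> \<rho> p \<le> \<rho> p\<^sub>0"
    using compact_attains_sup[of "\<rho> ` topspace M"] surface(4) by auto
  \<comment> \<open>The set of maximum points is closed by continuity and open by
    \<open>locally_constant\<close>, hence everything.\<close>
  define Z where "Z = {p \<in> topspace M. \<rho> p \<in> {\<rho> p\<^sub>0}}"
  have "closedin M Z"
    unfolding Z_def by (rule closedin_continuous_map_preimage[OF cont]) simp
  moreover have "openin M Z"
  proof (subst openin_subopen, intro ballI)
    fix p assume "p \<in> Z"
    then have p: "p \<in> topspace M" "\<rho> p = \<rho> p\<^sub>0"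
      by (auto simp: Z_def)
    then obtain c where c: "c \<in> A" "p \<in> fst c"
      using cover by blast
    interpret two_normalizations r M A x \<xi> c s y t y_aff
      using c(1) by (rule charts)
    have \<rho>: "- (\<epsilon> * \<sigma>) * \<mu> (snd c p') = \<rho> p'" if "p' \<in> fst c" for p'
      using in_chart_image(2)[OF first.is_chart that, of \<rho>] by (simp add: in_chart_\<rho>[OF c(1)])
    have h_pos: "0 < \<epsilon> * first.h u $ 1 $ 1" if u: "u \<in> first.D" for u
    proof -
      obtain p' where "p' \<in> fst c" "u = snd c p'"
        using u by (rule first.D_obtain)
      then show ?thesis
        using \<epsilon>(2)[OF c(1), of p'] by (simp add: first.second_form_eq)
    qed
    have F_sign: "0 \<le> \<sigma> * (relative_scalar_curvature c x \<xi> y p' / support_function \<xi> y p'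
        - relative_scalar_curvature c x \<xi> y_aff p' / support_function \<xi> y_aff p')" if "p' \<in> fst c" for p'
      using \<sigma>(2)[OF c(1) that] by (simp only: assms(10))
    have u: "snd c p \<in> first.D"
      using c(2) by (simp add: first.D_def)
    have max: "- (\<epsilon> * \<sigma>) * \<mu> v \<le> - (\<epsilon> * \<sigma>) * \<mu> (snd c p)" if v: "v \<in> first.D" for v
    proof -
      obtain p' where p': "p' \<in> fst c" "v = snd c p'"
        using v by (rule first.D_obtain)
      then have "\<rho> p' \<le> \<rho> p"
        using p(2) p\<^sub>0(2)[of p'] first.fst_subset by auto
      then show ?thesis
        unfolding p'(2) \<rho>[OF p'(1)] \<rho>[OF c(2)] .
    qed
    obtain E where E: "open E" "snd c p \<in> E" "E \<subseteq> first.D"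
      "\<And>v. v \<in> E \<Longrightarrow> - (\<epsilon> * \<sigma>) * \<mu> v = - (\<epsilon> * \<sigma>) * \<mu> (snd c p)"
    proof (rule locally_constant[OF \<epsilon>(1) h_pos F_sign u max])
      fix E assume "open E" "snd c p \<in> E" "E \<subseteq> first.D"
        "\<And>v. v \<in> E \<Longrightarrow> - (\<epsilon> * \<sigma>) * \<mu> v = - (\<epsilon> * \<sigma>) * \<mu> (snd c p)"
      then show thesis
        by (rule that)
    qed
    have "openin M {p' \<in> fst c. snd c p' \<in> E}"
      by (rule openin_chart_preimage[OF first.is_chart E(1)])
    moreover have "{p' \<in> fst c. snd c p' \<in> E} \<subseteq> Z"
    proof safe
      fix p' assume p': "p' \<in> fst c" "snd c p' \<in> E"
      have "\<rho> p' = \<rho> p"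
        using E(4)[OF p'(2)] unfolding \<rho>[OF p'(1)] \<rho>[OF c(2)] .
      then show "p' \<in> Z"
        using p(2) p'(1) first.fst_subset by (auto simp: Z_def)
    qed
    ultimately show "\<exists>T. openin M T \<and> p \<in> T \<and> T \<subseteq> Z"
      using c(2) E(2) by blast
  qed
  moreover have "p\<^sub>0 \<in> Z"
    using p\<^sub>0(1) by (simp add: Z_def)
  ultimately have "Z = topspace M"
    using surface(3) by (auto simp: connected_space_clopen_in)
  \<comment> \<open>The ratio of the two support functions at the maximum point, as an exponential
    and therefore nonzero.\<close>
  define k where "k = exp (ln (support_function \<xi> y p\<^sub>0) - ln (support_function \<xi> y_aff p\<^sub>0))"
  have "support_function \<xi> y p = k * support_function \<xi> y_aff p" if p: "p \<in> topspace M" for p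
  proof -
    have "\<rho> p = \<rho> p\<^sub>0"
      using p \<open>Z = topspace M\<close> by (auto simp: Z_def)
    then have "ln (support_function \<xi> y p) = (ln (support_function \<xi> y p\<^sub>0) - ln (support_function \<xi> y_aff p\<^sub>0))
        + ln (support_function \<xi> y_aff p)"
      using \<epsilon>(1) \<sigma>(1) by (auto simp: \<rho>_def)
    then have "exp (ln (support_function \<xi> y p)) = k * exp (ln (support_function \<xi> y_aff p))"
      unfolding k_def by (simp only: exp_add)
    moreover have "support_function \<xi> y_aff p > 0" "support_function \<xi> y p > 0"
      using p assms(6) cover q_aff by auto
    ultimately show ?thesis
      by simp
  qed
  then show ?thesis
    unfolding constantly_proportional_def by (intro exI[of _ k]) (simp add: k_def)
qed

end
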